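(* Let $I=[a,b]\subset\Omega\subset\mathbb{R}$ be a closed bounded interval ($a<b$) and let $f\in \mathrm{BV}(I)$ be left-continuous. If $p:\Omega\to[1,\infty)$ is bounded and satisfies the strong $\log$-Hölder condition $$\lim_{x\to y}|p(x)-p(y)|\,\log\Big(e+\frac1{|x-y|}\Big)=0\quad\text{uniformly in } y\in\Omega ,$$ then, for $\varphi(x,t):=t^{p(x)}$, we have $|D^sf|(\{p>1\})=0$ and $$\overline{\mathrm V}^\varphi_I(f)=\int_I |f'(x)|^{p(x)}\,dx+|D^sf|(\{p=1\}).$$
   Context: For $A\subset I$ let $\varphi^+_A(t):=\sup_{x\in A}\varphi(x,t)$. A partition $(I_k)_{k=1}^n$ of $I$ is a finite family of non-degenerate closed intervals with disjoint interiors and union $I$; $|(I_k)|:=\max_k|I_k|$. For $I_k=[a_k,b_k]$, $\Delta_kf:=f(a_k)-f(b_k)$. Define $$\overline{\mathrm V}^\varphi_I(f):=\limsup_{|(I_k)|\to0}\sum_{k=1}^n\varphi^+_{I_k}\Big(\frac{|\Delta_kf|}{|I_k|}\Big)|I_k|,$$ i.e. the limit as $\delta\to0^+$ of the supremum of the sums over all partitions with $|(I_k)|<\delta$. For a left-continuous function $f:[a,b]\to\mathbb{R}$ of bounded variation, $Df$ denotes the finite signed Borel measure on $I$ with $f(x)=f(a)+Df([a,x))$ for every $x\in I$ and $Df(\{b\})=0$ (so a jump of $f$ immediately to the right of $a$ is an atom of $Df$ at $a$). Its Lebesgue decomposition with respect to Lebesgue measure is $Df=f'\,dx+D^sf$,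 with $D^sf$ the singular part and $|D^sf|$ its total variation measure. The sets $\{p>1\}$ and $\{p=1\}$ are understood as subsets of $I$.
   Formalization: As printed the claim fails (p=2, f a step function with an interior jump); what is proved is that |D^s f|({p>1})=0 whenever the variation V is finite, and that the formula for V holds whenever |D^s f|({p>1})=0. *)

theory Defs
  imports "HOL-Analysis.Analysis"
begin

section \<open>Functions of bounded variation on an interval\<close>

definition bounded_variation_on :: "real \<Rightarrow> real \<Rightarrow> (real \<Rightarrow> real) \<Rightarrow> bool" where
  "bounded_variation_on a b f \<longleftrightarrow>
     (\<exists>B. \<forall>D. D division_of {a..b} \<longrightarrow> (\<Sum>K\<in>D. \<bar>f (Inf K) - f (Sup K)\<bar>) \<le> B)"

definition left_continuous_on :: "real \<Rightarrow> real \<Rightarrow> (real \<Rightarrow> real) \<Rightarrow> bool" where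
  "left_continuous_on a b f \<longleftrightarrow> (\<forall>x\<in>{a<..b}. continuous (at_left x) f)"

section \<open>The Riesz variation\<close>

text \<open>A \<^const>\<open>division_of\<close> may contain one-point intervals; these are excluded here.
  Non-degenerate intervals with disjoint interiors are pairwise distinct, so that a partition
  can be given as a set of intervals.\<close>

definition interval_partition :: "real \<Rightarrow> real \<Rightarrow> real set set \<Rightarrow> bool" where
  "interval_partition a b D \<longleftrightarrow> D division_of {a..b} \<and> (\<forall>K\<in>D. interior K \<noteq> {})"

definition mesh :: "real set set \<Rightarrow> real" where
  "mesh D = Max (measure lborel ` D)"

definition phi_plus :: "(real \<Rightarrow> real \<Rightarrow> ennreal) \<Rightarrow> real set \<Rightarrow> real \<Rightarrow> ennreal" where
  "phi_plus \<phi> A t = (SUP x\<in>A. \<phi> x t)"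

definition riesz_sum ::
    "(real \<Rightarrow> real \<Rightarrow> ennreal) \<Rightarrow> (real \<Rightarrow> real) \<Rightarrow> real set set \<Rightarrow> ennreal" where
  "riesz_sum \<phi> f D =
     (\<Sum>K\<in>D. phi_plus \<phi> K (\<bar>f (Inf K) - f (Sup K)\<bar> / measure lborel K) * ennreal (measure lborel K))"

definition riesz_variation ::
    "(real \<Rightarrow> real \<Rightarrow> ennreal) \<Rightarrow> real \<Rightarrow> real \<Rightarrow> (real \<Rightarrow> real) \<Rightarrow> ennreal" where
  "riesz_variation \<phi> a b f =
     Lim (at_right 0) (\<lambda>\<delta>. SUP D\<in>{D. interval_partition a b D \<and> mesh D < \<delta>}. riesz_sum \<phi> f D)"

section \<open>Finite signed measures\<close>

text \<open>A finite signed measure is a real-valued set function; the measure \<open>M\<close> only supplies the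
  \<open>\<sigma>\<close>-algebra, and values outside \<open>sets M\<close> are irrelevant.\<close>

definition signed_measure :: "'a measure \<Rightarrow> ('a set \<Rightarrow> real) \<Rightarrow> bool" where
  "signed_measure M \<nu> \<longleftrightarrow>
     \<nu> {} = 0 \<and>
     (\<forall>A :: nat \<Rightarrow> 'a set. range A \<subseteq> sets M \<longrightarrow> disjoint_family A \<longrightarrow>
        (\<lambda>n. \<nu> (A n)) sums \<nu> (\<Union>n. A n))"

definition total_variation :: "'a measure \<Rightarrow> ('a set \<Rightarrow> real) \<Rightarrow> 'a set \<Rightarrow> ennreal" where
  "total_variation M \<nu> A =
     (SUP P\<in>{P. finite P \<and> P \<subseteq> sets M \<and> disjoint P \<and> \<Union>P = A}. \<Sum>E\<in>P. ennreal \<bar>\<nu> E\<bar>)"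

abbreviation borel_on :: "real \<Rightarrow> real \<Rightarrow> real measure" where
  "borel_on a b \<equiv> restrict_space borel {a..b}"

text \<open>\<open>Df\<close> is the derivative measure of the left-continuous function \<open>f\<close>. The half-open interval
  \<open>{a..<x}\<close> puts a jump immediately to the right of \<open>a\<close> into the atom of \<open>Df\<close> at \<open>a\<close>.\<close>

definition derivative_measure ::
    "real \<Rightarrow> real \<Rightarrow> (real \<Rightarrow> real) \<Rightarrow> (real set \<Rightarrow> real) \<Rightarrow> bool" where
  "derivative_measure a b f Df \<longleftrightarrow>
     signed_measure (borel_on a b) Df \<and>
     (\<forall>x\<in>{a..b}. f x = f a + Df {a..<x}) \<and> Df {b} = 0"

definition lebesgue_singular :: "real \<Rightarrow> real \<Rightarrow> (real set \<Rightarrow> real) \<Rightarrow> bool" where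
  "lebesgue_singular a b \<nu> \<longleftrightarrow>
     (\<exists>N\<in>sets (borel_on a b). emeasure lborel N = 0 \<and>
        (\<forall>A\<in>sets (borel_on a b). A \<inter> N = {} \<longrightarrow> \<nu> A = 0))"

text \<open>The decomposition \<open>\<nu> = g dx + \<sigma>\<close>. The density \<open>g\<close> need only be Lebesgue measurable, so
  every function in its almost-everywhere class is admitted.\<close>

definition lebesgue_decomposition ::
    "real \<Rightarrow> real \<Rightarrow> (real set \<Rightarrow> real) \<Rightarrow> (real \<Rightarrow> real) \<Rightarrow> (real set \<Rightarrow> real) \<Rightarrow> bool" where
  "lebesgue_decomposition a b \<nu> g \<sigma> \<longleftrightarrow>
     set_integrable lebesgue {a..b} g \<and>
     signed_measure (borel_on a b) \<sigma> \<and> lebesgue_singular a b \<sigma> \<and>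
     (\<forall>A\<in>sets (borel_on a b). \<nu> A = (LINT x:A|lebesgue. g x) + \<sigma> A)"

section \<open>Variable exponents\<close>

definition strong_log_Hoelder :: "real set \<Rightarrow> (real \<Rightarrow> real) \<Rightarrow> bool" where
  "strong_log_Hoelder \<Omega> p \<longleftrightarrow>
     (\<forall>\<epsilon>>0. \<exists>\<delta>>0. \<forall>y\<in>\<Omega>. \<forall>x\<in>\<Omega>. x \<noteq> y \<and> \<bar>x - y\<bar> < \<delta> \<longrightarrow>
        \<bar>p x - p y\<bar> * ln (exp 1 + 1 / \<bar>x - y\<bar>) < \<epsilon>)"

end

(*
  Let N be a Lebesgue null set carrying the singular part, m the sum of Lebesgue measure and |D^s f|,
  and F the density of Df with respect to m, so that |F| = 1 on N and F = f' off N.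

  Lower bound. Young's inequality t^q >= q s^(q-1) sigma t - (q-1) s^q for |sigma| <= 1 bounds each
  term of a Riesz sum from below by an expression affine in the increment of f. For continuous sigma
  and s these sums converge, so that V dominates the integral of
  sigma p s^(p-1) F - (p-1) s^p 1_{-N} with respect to m. By approximation this holds for bounded
  Borel functions sigma and s. With sigma the sign of F, s = |F| truncated to [1/R, R] off N and s = R on N,
  Fatou's lemma for R -> infinity gives the integral of |f'|^p plus |D^s f|({p=1}) plus
  infinity times |D^s f|({p>1}).

  Upper bound. Difference quotients of f over an interval K are at most a constant over |K|, so the
  strong log-Hoelder condition permits replacing p by its minimum q over K at the cost of a factor
  near 1. Jensen's inequality and u^q <= u^p + (p - q) then bound the terms of a Riesz sum by
  integrals over the intervals K.
*)
theory Submission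
  imports Defs
begin

text \<open>The power of a difference quotient is nonlinear and singular mass concentrates on
  shrinking cells, so Riesz sums do not pass to the limit termwise. Young's inequality makes them
  linear in Df, and continuous test functions are dense in L^1(m), singular part included. Only the
  Lebesgue part of m multiplies the penalty (p-1) s^p; on N a large s costs nothing, which is the
  origin of the value infinity where p > 1. Increments of f are values of Df on half-open intervals
  [c,d). These tile [a,b) without counting an atom twice, and no mass sits at b. In the upper bound
  a slope t <= C/|K| raised to p - q is at most exp((p-q)(ln C + ln(1/|K|))). The strong condition
  makes this tend to 1, whereas a merely bounded product of oscillation and logarithm would leave a
  constant factor. Jensen's inequality survives the singular part because almost every point of N
  has p = 1: a cell containing such a point has q = 1, and the power is linear there.\<close>

section \<open>Hahn decomposition of finite signed measures\<close>

lemma signed_measure_empty: "signed_measure M \<nu> \<Longrightarrow> \<nu> {} = 0"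
  unfolding signed_measure_def by blast

lemma signed_measure_sums:
  "signed_measure M \<nu> \<Longrightarrow> range A \<subseteq> sets M \<Longrightarrow> disjoint_family A \<Longrightarrow>
    (\<lambda>n::nat. \<nu> (A n)) sums \<nu> (\<Union>n. A n)"
  unfolding signed_measure_def by blast

lemma signed_measure_Un:
  assumes "signed_measure M \<nu>" "A \<in> sets M" "B \<in> sets M" "A \<inter> B = {}"
  shows "\<nu> (A \<union> B) = \<nu> A + \<nu> B"
proof -
  have "disjoint_family (binaryset A B)"
    using assms(4) by (auto simp: disjoint_family_on_def binaryset_def)
  moreover have "range (binaryset A B) \<subseteq> sets M"
    using assms by (auto simp: range_binaryset_eq)
  ultimately have "(\<lambda>n. \<nu> (binaryset A B n)) sums \<nu> (A \<union> B)"
    using signed_measure_sums[OF assms(1)] by (metis UN_binaryset_eq)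
  moreover have "(\<lambda>n. \<nu> (binaryset A B n)) sums (\<nu> A + \<nu> B)"
    by (rule binaryset_sums) (rule signed_measure_empty[OF assms(1)])
  ultimately show ?thesis by (rule sums_unique2)
qed

lemma signed_measure_Diff:
  assumes "signed_measure M \<nu>" "A \<in> sets M" "B \<in> sets M" "B \<subseteq> A"
  shows "\<nu> (A - B) = \<nu> A - \<nu> B"
proof -
  have "\<nu> (B \<union> (A - B)) = \<nu> B + \<nu> (A - B)"
    using assms by (intro signed_measure_Un) auto
  moreover have "B \<union> (A - B) = A" using assms by auto
  ultimately show ?thesis by simp
qed

lemma signed_measure_split:
  assumes "signed_measure M \<nu>" "A \<in> sets M" "B \<in> sets M"
  shows "\<nu> A = \<nu> (A \<inter> B) + \<nu> (A - B)"
proof -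
  have "\<nu> ((A \<inter> B) \<union> (A - B)) = \<nu> (A \<inter> B) + \<nu> (A - B)"
    using assms by (intro signed_measure_Un) auto
  then show ?thesis by (simp add: Int_Diff_Un)
qed

definition positive_set :: "'a measure \<Rightarrow> ('a set \<Rightarrow> real) \<Rightarrow> 'a set \<Rightarrow> bool" where
  "positive_set M \<nu> P \<longleftrightarrow> P \<in> sets M \<and> (\<forall>C\<in>sets M. C \<subseteq> P \<longrightarrow> 0 \<le> \<nu> C)"

text \<open>No lower bound for \<open>\<nu>\<close> is available yet, so the defect
  \<open>- \<nu> C\<close> is capped at 1 to have a finite supremum. If the supremum is 0 the empty
  set serves; otherwise some subset exceeds half of it.\<close>

lemma exists_near_minimal_subset:
  assumes "signed_measure M \<nu>" "B \<in> sets M"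
  shows "\<exists>D\<in>sets M. D \<subseteq> B \<and> (\<forall>C\<in>sets M. C \<subseteq> B \<longrightarrow> min 1 (- \<nu> C) \<le> 2 * (- \<nu> D))"
proof -
  define S where "S = (\<lambda>C. min 1 (- \<nu> C)) ` {C \<in> sets M. C \<subseteq> B}"
  have bdd: "bdd_above S" unfolding S_def by (intro bdd_aboveI[of _ 1]) auto
  have upper: "min 1 (- \<nu> C) \<le> Sup S" if "C \<in> sets M" "C \<subseteq> B" for C
    using that bdd unfolding S_def by (intro cSup_upper) auto
  have nonneg: "0 \<le> Sup S"
    using upper[of "{}"] signed_measure_empty[OF assms(1)] by simp
  show ?thesis
  proof (cases "Sup S = 0")
    case True
    then show ?thesis
      using upper signed_measure_empty[OF assms(1)] by (intro bexI[of _ "{}"]) auto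
  next
    case False
    then have "Sup S / 2 < Sup S" using nonneg by simp
    moreover have "S \<noteq> {}" unfolding S_def by auto
    ultimately obtain z where "z \<in> S" "Sup S / 2 < z" using less_cSup_iff[OF _ bdd] by blast
    then obtain D where "D \<in> sets M" "D \<subseteq> B" "Sup S / 2 < min 1 (- \<nu> D)"
      unfolding S_def by blast
    then have "Sup S \<le> 2 * (- \<nu> D)" by linarith
    then have twice: "min 1 (- \<nu> C) \<le> 2 * (- \<nu> D)" if "C \<in> sets M" "C \<subseteq> B" for C
      using upper[OF that] by linarith
    have "D \<subseteq> B \<and> (\<forall>C\<in>sets M. C \<subseteq> B \<longrightarrow> min 1 (- \<nu> C) \<le> 2 * (- \<nu> D))"
      using \<open>D \<subseteq> B\<close> twice by blast
    then show ?thesis using \<open>D \<in> sets M\<close> by blast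
  qed
qed

text \<open>Greedy exhaustion: subsets of nearly most negative measure are removed repeatedly. They
  are disjoint, so their measures form a convergent series and tend to 0, and what remains has no
  subset of negative measure. Only nonpositive amounts are removed, hence \<open>\<nu>\<close> does
  not decrease.\<close>

lemma exists_positive_subset:
  assumes sm: "signed_measure M \<nu>" and A: "A \<in> sets M"
  shows "\<exists>B. B \<subseteq> A \<and> positive_set M \<nu> B \<and> \<nu> A \<le> \<nu> B"
proof -
  obtain d where d: "\<And>B. B \<in> sets M \<Longrightarrow> d B \<in> sets M \<and> d B \<subseteq> B \<and>
      (\<forall>C\<in>sets M. C \<subseteq> B \<longrightarrow> min 1 (- \<nu> C) \<le> 2 * (- \<nu> (d B)))"
    using exists_near_minimal_subset[OF sm] by metis
  define X where "X = rec_nat A (\<lambda>_ B. B - d B)"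
  have X_simps: "X 0 = A" "\<And>n. X (Suc n) = X n - d (X n)" by (auto simp: X_def)
  have X_sets: "X n \<in> sets M" for n
    by (induction n) (use A d in \<open>auto simp: X_simps\<close>)
  have X_anti: "X j \<subseteq> X i" if "i \<le> j" for i j
    using that by (induction rule: dec_induct) (auto simp: X_simps)
  define U where "U = (\<Union>n. d (X n))"
  have D_sets: "range (\<lambda>n. d (X n)) \<subseteq> sets M" using d X_sets by auto
  have "d (X i) \<inter> d (X j) = {}" if "i < j" for i j
    using d[OF X_sets[of j]] X_anti[of "Suc i" j] that by (auto simp: X_simps)
  then have disj: "disjoint_family (\<lambda>n. d (X n))"
    unfolding disjoint_family_on_def by (metis inf_commute linorder_neqE_nat)
  have sums: "(\<lambda>n. \<nu> (d (X n))) sums \<nu> U"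
    unfolding U_def by (rule signed_measure_sums[OF sm D_sets disj])
  \<comment> \<open>Comparison with \<open>C = {}\<close> in the choice of \<open>d\<close>.\<close>
  have nonpos: "\<nu> (d (X n)) \<le> 0" for n
    using d[OF X_sets[of n]] signed_measure_empty[OF sm] by force
  have U_sets: "U \<in> sets M" unfolding U_def using D_sets by (intro sets.countable_UN) auto
  have "d (X n) \<subseteq> A" for n using d[OF X_sets[of n]] X_anti[of 0 n] X_simps by auto
  then have UA: "U \<subseteq> A" unfolding U_def by auto
  have sub: "A - U \<subseteq> X n" for n
    by (induction n) (auto simp: X_simps U_def)
  have "0 \<le> \<nu> C" if "C \<in> sets M" "C \<subseteq> A - U" for C
  proof -
    have "(\<lambda>n. 2 * (- \<nu> (d (X n)))) \<longlonglongrightarrow> 2 * (- 0)"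
      by (intro tendsto_intros summable_LIMSEQ_zero[OF sums_summable[OF sums]])
    moreover have "min 1 (- \<nu> C) \<le> 2 * (- \<nu> (d (X n)))" for n
      using d[OF X_sets[of n]] that sub[of n] by auto
    ultimately have "min 1 (- \<nu> C) \<le> 2 * (-0)" by (intro LIMSEQ_le_const) auto
    then show ?thesis by auto
  qed
  moreover have "\<nu> U \<le> 0"
    using sums_le[OF _ sums sums_zero] nonpos by auto
  ultimately show ?thesis
    using signed_measure_Diff[OF sm A U_sets UA] A U_sets
    by (intro exI[of _ "A - U"]) (auto simp: positive_set_def)
qed

lemma positive_set_UN:
  assumes sm: "signed_measure M \<nu>" and P: "\<And>n::nat. positive_set M \<nu> (P n)"
  shows "positive_set M \<nu> (\<Union>n. P n)"
  unfolding positive_set_def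
proof safe
  show UN: "(\<Union>n. P n) \<in> sets M" using P unfolding positive_set_def by auto
  fix C assume C: "C \<in> sets M" "C \<subseteq> (\<Union>n. P n)"
  have P_sets: "range P \<subseteq> sets M" using P unfolding positive_set_def by auto
  have dP: "disjointed P n \<in> sets M" for n
    using sets.range_disjointed_sets[OF P_sets] by auto
  have "(\<lambda>n. \<nu> (C \<inter> disjointed P n)) sums \<nu> (\<Union>n. C \<inter> disjointed P n)"
    using C dP disjoint_family_disjointed[of P]
    by (intro signed_measure_sums[OF sm]) (fastforce simp: disjoint_family_on_def)+
  moreover have "(\<Union>n. C \<inter> disjointed P n) = C"
    using C UN_disjointed_eq[of P] by blast
  moreover have "0 \<le> \<nu> (C \<inter> disjointed P n)" for n
    using P[of n] C dP disjointed_subset[of P n] unfolding positive_set_def by blast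
  ultimately have "(\<lambda>n. \<nu> (C \<inter> disjointed P n)) sums \<nu> C"
    "\<And>n. 0 \<le> \<nu> (C \<inter> disjointed P n)" by simp_all
  then show "0 \<le> \<nu> C" using sums_le[of "\<lambda>_. 0" "\<lambda>n. \<nu> (C \<inter> disjointed P n)" 0 "\<nu> C"] by simp
qed

lemma positive_set_mono:
  assumes sm: "signed_measure M \<nu>" and "positive_set M \<nu> Q" "P \<in> sets M" "P \<subseteq> Q"
  shows "\<nu> P \<le> \<nu> Q"
proof -
  have "0 \<le> \<nu> (Q - P)" using assms unfolding positive_set_def by blast
  then show ?thesis
    using signed_measure_Diff[OF sm _ assms(3,4)] assms(2) unfolding positive_set_def by auto
qed

text \<open>The union of a maximizing sequence of positive sets is positive and dominates each
  member. The same union shows that the supremum is finite, because \<open>\<nu>\<close> takes real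
  values.\<close>

lemma exists_maximal_positive_set:
  assumes sm: "signed_measure M \<nu>"
  shows "\<exists>P. positive_set M \<nu> P \<and> (\<forall>Q. positive_set M \<nu> Q \<longrightarrow> \<nu> Q \<le> \<nu> P)"
proof -
  define T where "T = \<nu> ` {Q. positive_set M \<nu> Q}"
  have "{} \<in> {Q. positive_set M \<nu> Q}"
    using signed_measure_empty[OF sm] by (auto simp: positive_set_def)
  then have T_ne: "T \<noteq> {}" unfolding T_def by blast
  have bound: "\<nu> (P n) \<le> \<nu> (\<Union>n. P n)" if "\<And>n::nat. positive_set M \<nu> (P n)" for P n
  proof (rule positive_set_mono[OF sm])
    show "positive_set M \<nu> (\<Union>n. P n)" by (rule positive_set_UN[OF sm that])
    show "P n \<in> sets M" using that[of n] unfolding positive_set_def by blast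
  qed auto
  have bdd: "bdd_above T"
  proof (rule ccontr)
    assume "\<not> bdd_above T"
    then have "\<exists>Q. positive_set M \<nu> Q \<and> real n < \<nu> Q" for n
      unfolding T_def bdd_above_def by (auto simp: not_le)
    then obtain P where P: "\<And>n. positive_set M \<nu> (P n)" "\<And>n. real n < \<nu> (P n)" by metis
    obtain n where "\<nu> (\<Union>n. P n) < real n" using reals_Archimedean2 by blast
    then show False using bound[of P n, OF P(1)] P(2)[of n] by linarith
  qed
  have "\<exists>Q. positive_set M \<nu> Q \<and> Sup T - 1 / Suc n < \<nu> Q" for n
    using less_cSup_iff[OF T_ne bdd, of "Sup T - 1 / Suc n"] unfolding T_def by auto
  then obtain P where P: "\<And>n::nat. positive_set M \<nu> (P n)" "\<And>n. Sup T - 1 / Suc n < \<nu> (P n)"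
    by metis
  have "Sup T - 1 / Suc n \<le> \<nu> (\<Union>n. P n)" for n
    using P(2)[of n] bound[of P n, OF P(1)] by linarith
  moreover have "(\<lambda>n. Sup T - 1 / Suc n) \<longlonglongrightarrow> Sup T - 0"
    by (intro tendsto_diff tendsto_const LIMSEQ_Suc[OF lim_1_over_n])
  ultimately have "Sup T \<le> \<nu> (\<Union>n. P n)" by (intro LIMSEQ_le_const2) auto
  moreover have "\<nu> Q \<le> Sup T" if "positive_set M \<nu> Q" for Q
    using that bdd unfolding T_def by (intro cSup_upper) auto
  ultimately show ?thesis using positive_set_UN[of M \<nu> P, OF sm P(1)] by (meson order_trans)
qed

text \<open>A set \<open>C\<close> outside the maximal \<open>P\<close> contains a positive
  \<open>B\<close> with \<open>\<nu> C \<le> \<nu> B\<close>. Adjoining \<open>B\<close> to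
  \<open>P\<close> cannot increase the measure, so \<open>\<nu> B \<le> 0\<close>.\<close>

theorem signed_measure_Hahn_decomposition:
  assumes sm: "signed_measure M \<nu>"
  obtains P where "P \<in> sets M" "\<And>C. C \<in> sets M \<Longrightarrow> C \<subseteq> P \<Longrightarrow> 0 \<le> \<nu> C"
    "\<And>C. C \<in> sets M \<Longrightarrow> C \<inter> P = {} \<Longrightarrow> \<nu> C \<le> 0"
proof -
  obtain P where P: "positive_set M \<nu> P" "\<And>Q. positive_set M \<nu> Q \<Longrightarrow> \<nu> Q \<le> \<nu> P"
    using exists_maximal_positive_set[OF sm] by blast
  have "\<nu> C \<le> 0" if C: "C \<in> sets M" "C \<inter> P = {}" for C
  proof -
    obtain B where B: "B \<subseteq> C" "positive_set M \<nu> B" "\<nu> C \<le> \<nu> B"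
      using exists_positive_subset[OF sm C(1)] by blast
    have "positive_set M \<nu> (\<Union>n::nat. if n = 0 then P else B)"
      by (rule positive_set_UN[OF sm]) (use P B in auto)
    moreover have "(\<Union>n::nat. if n = 0 then P else B) = P \<union> B" by (auto split: if_splits)
    ultimately have "\<nu> (P \<union> B) \<le> \<nu> P" using P(2) by simp
    moreover have "\<nu> (P \<union> B) = \<nu> P + \<nu> B"
      using P(1) B C by (intro signed_measure_Un[OF sm]) (auto simp: positive_set_def)
    ultimately show ?thesis using B(3) by simp
  qed
  then show ?thesis using that P(1) unfolding positive_set_def by blast
qed

section \<open>Approximation by continuous functions\<close>

text \<open>Regularity encloses \<open>A\<close> between a compact \<open>K\<close> and an open
  \<open>U\<close> with \<open>U - K\<close> of measure below \<open>e\<close>. A Urysohn function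
  equal to 1 on \<open>K\<close> and 0 off \<open>U\<close> differs from the indicator only on
  \<open>U - K\<close>, by at most 1.\<close>

lemma continuous_L1_approx_indicator:
  fixes M :: "real measure"
  assumes fin: "finite_measure M" and sets: "sets M = sets borel" and A: "A \<in> sets borel"
    and e: "0 < (e::real)"
  shows "\<exists>g. continuous_on UNIV g \<and> (\<forall>x. \<bar>g x\<bar> \<le> 1) \<and>
    (LINT x|M. \<bar>indicator A x - g x\<bar>) < e"
proof -
  interpret finite_measure M by fact
  have finM: "emeasure M (space M) \<noteq> \<infinity>" by simp
  have "emeasure M A < emeasure M A + ennreal (e/2)"
    using e by (simp add: emeasure_eq_measure ennreal_less_iff flip: ennreal_plus)
  then obtain U where U: "A \<subseteq> U" "open U" "emeasure M U < emeasure M A + ennreal (e/2)"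
    unfolding outer_regular[OF sets finM A] INF_less_iff by auto
  \<comment> \<open>Subtraction on \<open>ennreal\<close> stops at 0, so the strict inequality fails
    for a null set; there \<open>K = {}\<close> serves.\<close>
  have "emeasure M A - ennreal (e/2) < emeasure M A \<or> emeasure M A = 0"
  proof (cases "measure M A = 0")
    case False
    then have "0 < measure M A" using measure_nonneg[of M A] by linarith
    then have "ennreal (measure M A - e/2) < ennreal (measure M A)"
      using e by (intro ennreal_lessI) auto
    then show ?thesis using e by (simp add: emeasure_eq_measure ennreal_minus)
  qed (simp add: emeasure_eq_measure)
  then have "\<exists>K. K \<subseteq> A \<and> compact K \<and> emeasure M A - ennreal (e/2) \<le> emeasure M K"
  proof
    assume "emeasure M A - ennreal (e/2) < emeasure M A"
    then obtain K where "K \<subseteq> A" "compact K" "emeasure M A - ennreal (e/2) < emeasure M K"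
      using inner_regular[OF sets finM A] less_SUP_iff[of "emeasure M A - ennreal (e/2)" "emeasure M"]
      by auto
    then show ?thesis by (auto intro: less_imp_le)
  qed (auto intro: exI[of _ "{}"])
  then obtain K where K: "K \<subseteq> A" "compact K" "emeasure M A - ennreal (e/2) \<le> emeasure M K" by blast
  have meas: "K \<in> sets M" "U \<in> sets M" "A \<in> sets M"
    using K(2) U(2) A by (auto simp: sets borel_compact)
  have "measure M U < measure M A + e/2"
    using U(3) e by (simp add: emeasure_eq_measure ennreal_less_iff flip: ennreal_plus)
  moreover have "measure M A - e/2 \<le> measure M K"
    using K(3) e by (simp add: emeasure_eq_measure ennreal_minus)
  ultimately have small: "measure M (U - K) < e"
    using finite_measure_Diff[OF meas(2,1)] K(1) U(1) by auto
  obtain g :: "real \<Rightarrow> real" where g: "continuous_on UNIV g"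
      "\<And>x. g x \<in> closed_segment 1 0" "\<And>x. x \<in> K \<Longrightarrow> g x = 1" "\<And>x. x \<in> - U \<Longrightarrow> g x = 0"
    using Urysohn[of K "- U" "1::real" 0] K U by (auto simp: compact_imp_closed closed_Compl)
  have g01: "0 \<le> g x" "g x \<le> 1" for x
    using g(2)[of x] by (auto simp: closed_segment_eq_real_ivl)
  have gm: "g \<in> borel_measurable M"
    using borel_measurable_continuous_onI[OF g(1)] by (simp add: measurable_cong_sets[OF sets refl])
  have "(LINT x|M. \<bar>indicator A x - g x\<bar>) \<le> (LINT x|M. indicator (U - K) x)"
  proof (rule integral_mono)
    show "integrable M (\<lambda>x. \<bar>indicator A x - g x\<bar>)"
      by (rule integrable_const_bound[of _ 1])
        (use gm meas g01 in \<open>auto simp: indicator_def intro!: AE_I2 order_trans[OF _ g01(1)] order_trans[OF g01(2)]\<close>)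
    show "integrable M (indicator (U - K) :: real \<Rightarrow> real)"
      using meas by (simp add: integrable_indicator_iff emeasure_eq_measure)
    show "\<bar>indicator A x - g x\<bar> \<le> indicator (U - K) x" for x
      using g01[of x] g(3,4)[of x] K(1) U(1) by (auto simp: indicator_def)
  qed
  also have "\<dots> = measure M (U - K)" using meas by simp
  finally show ?thesis using g(1) g01 small by (intro exI[of _ g]) auto
qed

lemma integrable_between:
  fixes h :: "'a \<Rightarrow> real"
  assumes "finite_measure M" "h \<in> borel_measurable M" "\<And>x. lo \<le> h x" "\<And>x. h x \<le> hi"
  shows "integrable M h"
proof -
  have "\<bar>h x\<bar> \<le> max \<bar>lo\<bar> \<bar>hi\<bar>" for x using assms(3,4)[of x] by linarith
  then show ?thesis
    using assms(2) by (intro finite_measure.integrable_const_bound[OF assms(1)] AE_I2) auto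
qed

lemma integrable_bounded_continuous:
  fixes M :: "real measure" and g :: "real \<Rightarrow> real"
  assumes fin: "finite_measure M" and sets: "sets M = sets borel"
    and "continuous_on UNIV g" "bounded (range g)"
  shows "integrable M g"
proof -
  obtain B where "\<And>x. \<bar>g x\<bar> \<le> B" using assms(4) by (auto simp: bounded_iff)
  then show ?thesis
    using borel_measurable_continuous_onI[OF assms(3)]
    by (intro finite_measure.integrable_const_bound[OF fin, of _ B])
      (auto simp: measurable_cong_sets[OF sets refl])
qed

lemma continuous_L1_approx:
  fixes M :: "real measure" and h :: "real \<Rightarrow> real"
  assumes fin: "finite_measure M" and sets: "sets M = sets borel" and h: "integrable M h"
    and e: "0 < (e::real)"
  shows "\<exists>g. continuous_on UNIV g \<and> bounded (range g) \<and> (LINT x|M. \<bar>h x - g x\<bar>) < e"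
  using h e
proof (induction h arbitrary: e rule: integrable_induct)
  interpret finite_measure M by fact
  note int = integrable_bounded_continuous[OF fin sets]
  {
    case (base A c)
    \<comment> \<open>The summand 1 in the denominator covers \<open>c = 0\<close>.\<close>
    obtain g where g: "continuous_on UNIV g" "\<And>x. \<bar>g x\<bar> \<le> 1"
      "(LINT x|M. \<bar>indicator A x - g x\<bar>) < e / (\<bar>c\<bar> + 1)"
      using continuous_L1_approx_indicator[OF fin sets, of A "e / (\<bar>c\<bar> + 1)"] base sets by auto
    have "(LINT x|M. \<bar>indicator A x *\<^sub>R c - g x * c\<bar>) = (LINT x|M. \<bar>indicator A x - g x\<bar> * \<bar>c\<bar>)"
      by (intro Bochner_Integration.integral_cong) (auto simp: algebra_simps simp flip: abs_mult)
    also have "\<dots> = (LINT x|M. \<bar>indicator A x - g x\<bar>) * \<bar>c\<bar>" by simp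
    also have "\<dots> \<le> e / (\<bar>c\<bar> + 1) * \<bar>c\<bar>"
      using g(3) by (intro mult_right_mono) auto
    also have "\<dots> < e" using base by (simp add: field_simps)
    finally have "(LINT x|M. \<bar>indicator A x *\<^sub>R c - g x * c\<bar>) < e" .
    moreover have "\<bar>g x * c\<bar> \<le> \<bar>c\<bar>" for x
      using mult_right_mono[OF g(2), of "\<bar>c\<bar>" x] by (simp add: abs_mult)
    then have "bounded (range (\<lambda>x. g x * c))"
      by (auto simp: bounded_iff intro!: exI[of _ "\<bar>c\<bar>"])
    ultimately show ?case
      using g(1) by (intro exI[of _ "\<lambda>x. g x * c"]) (auto intro!: continuous_intros)
  next
    case (add u v)
    obtain g1 where g1: "continuous_on UNIV g1" "bounded (range g1)" "(LINT x|M. \<bar>u x - g1 x\<bar>) < e / 2"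
      using add(3)[of "e/2"] add(5) by auto
    obtain g2 where g2: "continuous_on UNIV g2" "bounded (range g2)" "(LINT x|M. \<bar>v x - g2 x\<bar>) < e / 2"
      using add(4)[of "e/2"] add(5) by auto
    have i: "integrable M (\<lambda>x. \<bar>u x - g1 x\<bar>)" "integrable M (\<lambda>x. \<bar>v x - g2 x\<bar>)"
      using add(1,2) int g1 g2 by auto
    have "(LINT x|M. \<bar>(u x + v x) - (g1 x + g2 x)\<bar>) \<le> (LINT x|M. \<bar>u x - g1 x\<bar> + \<bar>v x - g2 x\<bar>)"
      using add(1,2) int g1 g2 i by (intro integral_mono) auto
    also have "\<dots> < e" using i g1 g2 by simp
    finally show ?case
      using g1 g2 by (intro exI[of _ "\<lambda>x. g1 x + g2 x"])
        (auto intro!: continuous_intros bounded_plus_comp)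
  next
    case (lim h s)
    have "(\<lambda>i. LINT x|M. \<bar>h x - s i x\<bar>) \<longlonglongrightarrow> (LINT x|M. 0)"
    \<comment> \<open>The induction rule supplies
      \<open>\<bar>s i x\<bar> \<le> 2 * \<bar>h x\<bar>\<close>, whence the factor 3.\<close>
    proof (rule integral_dominated_convergence[where w="\<lambda>x. 3 * \<bar>h x\<bar>"])
      show "AE x in M. (\<lambda>i. \<bar>h x - s i x\<bar>) \<longlonglongrightarrow> 0"
      proof (rule AE_I2)
        fix x assume "x \<in> space M"
        then have "(\<lambda>i. \<bar>h x - s i x\<bar>) \<longlonglongrightarrow> \<bar>h x - h x\<bar>" by (intro tendsto_intros lim(2))
        then show "(\<lambda>i. \<bar>h x - s i x\<bar>) \<longlonglongrightarrow> 0" by simp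
      qed
      show "AE x in M. norm \<bar>h x - s i x\<bar> \<le> 3 * \<bar>h x\<bar>" for i
        
      proof (rule AE_I2)
        fix x assume "x \<in> space M"
        then have "\<bar>s i x\<bar> \<le> 2 * \<bar>h x\<bar>" using lim(3)[of x i] by simp
        then show "norm \<bar>h x - s i x\<bar> \<le> 3 * \<bar>h x\<bar>" unfolding real_norm_def by linarith
      qed
    qed (use lim(1,4) in auto)
    then have "eventually (\<lambda>i. (LINT x|M. \<bar>h x - s i x\<bar>) < e/2) sequentially"
      using lim(6) by (intro order_tendstoD(2)) auto
    then obtain i where i: "(LINT x|M. \<bar>h x - s i x\<bar>) < e/2"
      by (auto dest: eventually_happens)
    obtain g where g: "continuous_on UNIV g" "bounded (range g)" "(LINT x|M. \<bar>s i x - g x\<bar>) < e / 2"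
      using lim(5)[of "e/2"] lim(6) by auto
    have j: "integrable M (\<lambda>x. \<bar>h x - s i x\<bar>)" "integrable M (\<lambda>x. \<bar>s i x - g x\<bar>)"
      using lim(1,4) int g by auto
    have "(LINT x|M. \<bar>h x - g x\<bar>) \<le> (LINT x|M. \<bar>h x - s i x\<bar> + \<bar>s i x - g x\<bar>)"
      using lim(1,4) int g j by (intro integral_mono) auto
    also have "\<dots> < e" using i j g(3) by simp
    finally show ?case using g by blast
  }
qed

text \<open>Clipping an L^1 approximation to \<open>[lo, hi]\<close> takes it no farther from
  \<open>h\<close>, whose values lie there; L^1 convergence then gives an almost everywhere
  convergent subsequence. The preserved bounds provide majorants for dominated convergence.\<close>

lemma continuous_AE_approx:
  fixes M :: "real measure" and h :: "real \<Rightarrow> real"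
  assumes fin: "finite_measure M" and sets: "sets M = sets borel"
    and h: "h \<in> borel_measurable borel" "\<And>x. lo \<le> h x" "\<And>x. h x \<le> hi"
  obtains g where "\<And>n::nat. continuous_on UNIV (g n)" "\<And>n x. lo \<le> g n x" "\<And>n x. g n x \<le> hi"
    "AE x in M. (\<lambda>n. g n x) \<longlonglongrightarrow> h x"
proof -
  interpret finite_measure M by fact
  have hM: "h \<in> borel_measurable M"
    using h(1) by (simp add: measurable_cong_sets[OF sets refl])
  have int_h: "integrable M h"
    by (rule integrable_between[OF fin hM h(2,3)])
  have "\<exists>g. continuous_on UNIV g \<and> bounded (range g) \<and> (LINT x|M. \<bar>h x - g x\<bar>) < 1 / Suc n" for n
    using continuous_L1_approx[OF fin sets int_h, of "1 / Suc n"] by auto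
  then obtain g where g: "\<And>n::nat. continuous_on UNIV (g n)"
      "\<And>n. bounded (range (g n))" "\<And>n. (LINT x|M. \<bar>h x - g n x\<bar>) < 1 / Suc n" by metis
  define k where "k n x = max lo (min hi (g n x))" for n x
  have lohi: "lo \<le> hi" using h(2,3) by (meson order_trans)
  have k: "continuous_on UNIV (k n)" "lo \<le> k n x" "k n x \<le> hi" for n x
    unfolding k_def using g(1) lohi by (auto intro!: continuous_intros)
  have kM: "k n \<in> borel_measurable M" for n
    using borel_measurable_continuous_onI[OF k(1)] by (simp add: measurable_cong_sets[OF sets refl])
  have int: "integrable M (\<lambda>x. k n x - h x)" "integrable M (\<lambda>x. \<bar>h x - g n x\<bar>)" for n
  proof -
    have "integrable M (k n)"
      by (rule integrable_between[OF fin kM k(2,3)])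
    then show "integrable M (\<lambda>x. k n x - h x)" using int_h by simp
    show "integrable M (\<lambda>x. \<bar>h x - g n x\<bar>)" using int_h integrable_bounded_continuous[OF fin sets g(1,2)] by simp
  qed
  have le: "(LINT x|M. norm (k n x - h x)) \<le> 1 / Suc n" for n
  proof -
    have "(LINT x|M. norm (k n x - h x)) \<le> (LINT x|M. \<bar>h x - g n x\<bar>)"
    proof (rule integral_mono)
      show "norm (k n x - h x) \<le> \<bar>h x - g n x\<bar>" for x
        using h(2,3)[of x] by (auto simp: k_def max_def min_def)
    qed (use int in auto)
    then show ?thesis using g(3)[of n] by simp
  qed
  have "(\<lambda>n. LINT x|M. norm (k n x - h x)) \<longlonglongrightarrow> 0"
  proof (rule tendsto_sandwich[where f="\<lambda>_. 0" and h="\<lambda>n. 1 / real (Suc n)"])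
    show "(\<lambda>n. 1 / real (Suc n)) \<longlonglongrightarrow> 0" by (rule LIMSEQ_Suc[OF lim_1_over_n])
    show "\<forall>\<^sub>F n in sequentially. (LINT x|M. norm (k n x - h x)) \<le> 1 / real (Suc n)"
      using le by (intro always_eventually allI)
  qed (auto intro!: always_eventually)
  then obtain r :: "nat \<Rightarrow> nat" where r: "AE x in M. (\<lambda>n. k (r n) x - h x) \<longlonglongrightarrow> 0"
    using tendsto_L1_AE_subseq[of M "\<lambda>n x. k n x - h x"] int(1) by blast
  have "AE x in M. (\<lambda>n. k (r n) x) \<longlonglongrightarrow> h x"
    using r by eventually_elim (rule LIM_zero_cancel)
  then show ?thesis using that[of "\<lambda>n. k (r n)"] k by blast
qed

section \<open>Partitions and the Riesz variation\<close>

lemma interval_partition_elem: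
  assumes "interval_partition a b D" "K \<in> D"
  shows "K = {Inf K..Sup K}" "a \<le> Inf K" "Inf K < Sup K" "Sup K \<le> b"
    "measure lborel K = Sup K - Inf K"
proof -
  have D: "D division_of {a..b}" and ne: "interior K \<noteq> {}"
    using assms unfolding interval_partition_def by auto
  obtain c d where K: "K = {c..d}" using division_ofD(4)[OF D assms(2)] by auto
  then have cd: "c < d" using ne by simp
  moreover have "{c..d} \<subseteq> {a..b}" using division_ofD(2)[OF D assms(2)] K by simp
  ultimately show "K = {Inf K..Sup K}" "a \<le> Inf K" "Inf K < Sup K" "Sup K \<le> b"
    "measure lborel K = Sup K - Inf K"
    using K by auto
qed

text \<open>The finitely many cells that start to the right of \<open>x\<close> have a closed union
  \<open>U\<close> missing \<open>x\<close>, so some \<open>z\<close> just to the right of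
  \<open>x\<close> avoids \<open>U\<close>. The cell containing \<open>z\<close> starts at or before
  \<open>x\<close> and ends after it.\<close>

lemma interval_partition_cover:
  assumes D: "interval_partition a b D" and x: "x \<in> {a..<b}"
  shows "\<exists>K\<in>D. x \<in> {Inf K..<Sup K}"
proof -
  have div: "D division_of {a..b}" using D unfolding interval_partition_def by simp
  define U where "U = \<Union>{K\<in>D. x < Inf K}"
  have "closed U"
    unfolding U_def
  proof (intro closed_Union ballI)
    show "finite {K \<in> D. x < Inf K}" using division_ofD(1)[OF div] by simp
    fix K assume "K \<in> {K \<in> D. x < Inf K}"
    then have "K = {Inf K..Sup K}" using interval_partition_elem(1)[OF D] by blast
    then show "closed K" by (metis closed_real_atLeastAtMost)
  qed
  moreover have "x \<notin> U"
    unfolding U_def using interval_partition_elem(1)[OF D] by (force simp: set_eq_iff)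
  ultimately obtain e where e: "0 < e" "ball x e \<subseteq> - U"
    using openE[of "- U" x] by (auto simp: open_Compl)
  \<comment> \<open>The first bound keeps \<open>z\<close> in the ball, the midpoint keeps it below
    \<open>b\<close>.\<close>
  define z where "z = min (x + e/2) ((x + b) / 2)"
  have z: "x < z" "z < b" "z \<notin> U"
  proof -
    have "min (x + e/2) ((x + b) / 2) \<le> (x + b) / 2" "min (x + e/2) ((x + b) / 2) \<le> x + e/2"
      by (rule min.cobounded2, rule min.cobounded1)
    moreover have "x < min (x + e/2) ((x + b) / 2)" using e(1) x by simp
    ultimately show "x < z" "z < b" using x unfolding z_def by auto
    then have "z \<in> ball x e"
      using \<open>min (x + e/2) ((x + b) / 2) \<le> x + e/2\<close> e(1) unfolding z_def[symmetric]
      by (simp add: dist_real_def)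
    then show "z \<notin> U" using e(2) by blast
  qed
  then have "z \<in> \<Union>D" using x division_ofD(6)[OF div] by auto
  then obtain K where K: "K \<in> D" "z \<in> K" by blast
  have "z \<in> {Inf K..Sup K}" using K(2) interval_partition_elem(1)[OF D K(1)] by simp
  have "\<not> x < Inf K" using K z(3) unfolding U_def by blast
  then show ?thesis using K(1) z(1) \<open>z \<in> {Inf K..Sup K}\<close> by (intro bexI[of _ K]) auto
qed

text \<open>Half-open cells that share a point also share an open interval to its right, which
  contradicts disjoint interiors.\<close>

lemma interval_partition_disjoint:
  assumes D: "interval_partition a b D" and K: "K \<in> D" "L \<in> D"
    "x \<in> {Inf K..<Sup K}" "x \<in> {Inf L..<Sup L}"
  shows "K = L"
proof (rule ccontr)
  assume "K \<noteq> L"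
  moreover have "D division_of {a..b}" using D unfolding interval_partition_def by simp
  ultimately have disj: "interior K \<inter> interior L = {}" using division_ofD(5) K(1,2) by blast
  define z where "z = (x + min (Sup K) (Sup L)) / 2"
  have "z \<in> {Inf K<..<Sup K} \<inter> {Inf L<..<Sup L}"
    using K(3,4) by (auto simp: z_def min_def field_simps)
  moreover have "interior K = {Inf K<..<Sup K}" "interior L = {Inf L<..<Sup L}"
    using interval_partition_elem(1)[OF D] K(1,2) by (metis interior_atLeastAtMost_real)+
  ultimately show False using disj by auto
qed

lemma interval_partition_sum_indicator:
  assumes D: "interval_partition a b D"
  shows "(\<Sum>K\<in>D. indicator {Inf K..<Sup K} x :: real) = indicator {a..<b} x"
proof (cases "x \<in> {a..<b}")
  case True
  then obtain K where K: "K \<in> D" "x \<in> {Inf K..<Sup K}"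
    using interval_partition_cover[OF D] by blast
  have "finite D" using D unfolding interval_partition_def by auto
  then have "(\<Sum>L\<in>D. indicator {Inf L..<Sup L} x :: real) = (\<Sum>L\<in>D. if L = K then 1 else 0)"
    using K(2) interval_partition_disjoint[OF D _ K(1) _ K(2)]
    by (intro sum.cong refl) (metis indicator_simps)
  then show ?thesis using True K \<open>finite D\<close> by simp
next
  case False
  have "x \<notin> {Inf K..<Sup K}" if K: "K \<in> D" for K
    using False interval_partition_elem(2,4)[OF D K] by auto
  then show ?thesis using False by simp
qed

text \<open>The half-open cells miss \<open>b\<close>; concentration of \<open>M\<close> on
  \<open>{a..<b}\<close> makes this harmless.\<close>

lemma interval_partition_sum_integral:
  fixes h :: "real \<Rightarrow> real"
  assumes D: "interval_partition a b D" and M: "sets M = sets borel" "AE x in M. x \<in> {a..<b}"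
    and h: "integrable M h"
  shows "(\<Sum>K\<in>D. LINT x:{Inf K..<Sup K}|M. h x) = (LINT x|M. h x)"
proof -
  have "(\<Sum>K\<in>D. LINT x:{Inf K..<Sup K}|M. h x) =
      (LINT x|M. (\<Sum>K\<in>D. indicator {Inf K..<Sup K} x *\<^sub>R h x))"
    unfolding set_lebesgue_integral_def
    by (intro Bochner_Integration.integral_sum[symmetric] integrable_mult_indicator)
      (auto simp: M(1) h)
  also have "\<dots> = (LINT x|M. indicator {a..<b} x *\<^sub>R h x)"
    by (simp add: sum_distrib_right[symmetric] interval_partition_sum_indicator[OF D])
  also have "\<dots> = (LINT x|M. h x)"
  proof (rule integral_cong_AE)
    show "AE x in M. indicator {a..<b} x *\<^sub>R h x = h x" using M(2) by eventually_elim auto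
    show "(\<lambda>x. indicator {a..<b} x *\<^sub>R h x) \<in> borel_measurable M"
      using h by (intro borel_measurable_scaleR borel_measurable_indicator) (auto simp: M(1))
  qed (use h in auto)
  finally show ?thesis .
qed

section \<open>Fine partitions and the limit that defines the variation\<close>

lemma measure_le_mesh:
  assumes "interval_partition a b D" "K \<in> D"
  shows "measure lborel K \<le> mesh D"
proof -
  have "finite D" using assms(1) unfolding interval_partition_def by blast
  then show ?thesis unfolding mesh_def using assms(2) by (intro Max_ge) simp_all
qed

text \<open>Cousin's lemma with the constant gauge of radius \<open>\<delta>/3\<close>: a cell
  inside such a ball is shorter than \<open>\<delta>\<close>. Cells of length 0 are discarded, as
  \<open>interval_partition\<close> demands.\<close>

lemma exists_fine_interval_partition:
  assumes "a < b" "0 < \<delta>"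
  shows "\<exists>D. interval_partition a b D \<and> mesh D < \<delta>"
proof -
  obtain T where T: "T tagged_division_of {a..b}" "(\<lambda>x. ball x (\<delta>/3)) fine T"
    using fine_division_exists_real[OF gauge_ball[of "\<delta>/3"]] assms(2) by auto
  define D where "D = {K \<in> snd ` T. measure lborel K \<noteq> 0}"
  have div: "D division_of {a..b}"
    unfolding D_def using division_of_nontrivial[of "snd ` T" a b] division_of_tagged_division[OF T(1)] assms(1)
    by simp
  moreover have "interior K \<noteq> {}" if K: "K \<in> D" for K
  proof -
    obtain c d where "K = cbox c d" using division_ofD(4)[OF div K] by auto
    then show ?thesis using K content_eq_0_interior[of c d] unfolding D_def by blast
  qed
  ultimately have part: "interval_partition a b D" unfolding interval_partition_def by simp
  have "measure lborel K < \<delta>" if K: "K \<in> D" for K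
  proof -
    obtain x where "(x, K) \<in> T" using K unfolding D_def by auto
    then have sub: "K \<subseteq> ball x (\<delta>/3)" using T(2) unfolding fine_def by blast
    have "Inf K \<in> {Inf K..Sup K}" "Sup K \<in> {Inf K..Sup K}"
      using interval_partition_elem(3)[OF part K] by auto
    then have "Inf K \<in> ball x (\<delta>/3)" "Sup K \<in> ball x (\<delta>/3)"
      using sub interval_partition_elem(1)[OF part K] by auto
    then have "\<bar>x - Inf K\<bar> < \<delta>/3" "\<bar>x - Sup K\<bar> < \<delta>/3" by (auto simp: dist_real_def)
    then show ?thesis using interval_partition_elem(5)[OF part K] assms(2) by linarith
  qed
  moreover have "finite D" "D \<noteq> {}"
    using div assms(1) by (auto simp: division_of_def)
  ultimately have "mesh D < \<delta>" unfolding mesh_def by simp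
  then show ?thesis using part by blast
qed

text \<open>The inner supremum is monotone in the mesh bound, so its right limit at 0 exists and is
  the infimum. Convergence has to be proved because \<open>Lim\<close> is informative only for
  convergent functions.\<close>

lemma riesz_variation_eq_INF:
  "riesz_variation \<phi> a b f =
    (INF \<delta>\<in>{0<..}. SUP D\<in>{D. interval_partition a b D \<and> mesh D < \<delta>}. riesz_sum \<phi> f D)"
proof -
  define \<Phi> where "\<Phi> \<delta> = (SUP D\<in>{D. interval_partition a b D \<and> mesh D < \<delta>}. riesz_sum \<phi> f D)" for \<delta>
  have mono: "\<Phi> \<delta> \<le> \<Phi> \<delta>'" if "\<delta> \<le> \<delta>'" for \<delta> \<delta>'
    unfolding \<Phi>_def using that by (intro SUP_subset_mono) auto
  have "(\<Phi> \<longlongrightarrow> (INF \<delta>\<in>{0<..}. \<Phi> \<delta>)) (at_right 0)"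
  proof (rule order_tendstoI)
    fix y assume "y < (INF \<delta>\<in>{0<..}. \<Phi> \<delta>)"
    then have "y < \<Phi> \<delta>" if "0 < \<delta>" for \<delta>
      using that by (meson INF_lower greaterThan_iff less_le_trans)
    then show "\<forall>\<^sub>F \<delta> in at_right 0. y < \<Phi> \<delta>" by (auto simp: eventually_at_right_field intro: exI[of _ 1])
  next
    fix y assume "(INF \<delta>\<in>{0<..}. \<Phi> \<delta>) < y"
    then obtain \<delta> where "0 < \<delta>" "\<Phi> \<delta> < y" by (auto simp: INF_less_iff)
    then show "\<forall>\<^sub>F \<delta> in at_right 0. \<Phi> \<delta> < y"
      using mono by (auto simp: eventually_at_right_field intro!: exI[of _ \<delta>] intro: le_less_trans less_imp_le)
  qed
  then have "Lim (at_right 0) \<Phi> = (INF \<delta>\<in>{0<..}. \<Phi> \<delta>)" by (intro tendsto_Lim) auto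
  then show ?thesis unfolding riesz_variation_def \<Phi>_def .
qed

lemma riesz_variation_ge:
  assumes "a < b" "0 < \<delta>0"
    and "\<And>D. interval_partition a b D \<Longrightarrow> mesh D < \<delta>0 \<Longrightarrow> L \<le> riesz_sum \<phi> f D"
  shows "L \<le> riesz_variation \<phi> a b f"
  unfolding riesz_variation_eq_INF
proof (rule INF_greatest)
  fix \<delta> :: real assume "\<delta> \<in> {0<..}"
  then obtain D where "interval_partition a b D" "mesh D < min \<delta> \<delta>0"
    using exists_fine_interval_partition[OF assms(1), of "min \<delta> \<delta>0"] assms(2) by auto
  then show "L \<le> (SUP D\<in>{D. interval_partition a b D \<and> mesh D < \<delta>}. riesz_sum \<phi> f D)"
    using assms(3) by (intro SUP_upper2[of D]) auto
qed

lemma riesz_variation_le: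
  assumes "0 < \<delta>"
    and "\<And>D. interval_partition a b D \<Longrightarrow> mesh D < \<delta> \<Longrightarrow> riesz_sum \<phi> f D \<le> L"
  shows "riesz_variation \<phi> a b f \<le> L"
  unfolding riesz_variation_eq_INF
proof (rule INF_lower2)
  show "\<delta> \<in> {0<..}" using assms(1) by simp
  show "(SUP D\<in>{D. interval_partition a b D \<and> mesh D < \<delta>}. riesz_sum \<phi> f D) \<le> L"
    using assms(2) by (intro SUP_least) blast
qed

text \<open>The tangent to the convex function \<open>t powr q\<close> at \<open>t = s\<close>,
  obtained from Young's inequality for \<open>t\<close> and \<open>s powr (q - 1)\<close> with
  conjugate exponents \<open>q\<close> and \<open>q / (q - 1)\<close>. For \<open>q = 1\<close>
  there is no finite conjugate, hence the case split.\<close>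

lemma young_powr:
  fixes t s q :: real
  assumes "0 \<le> t" "0 \<le> s" "1 \<le> q"
  shows "q * s powr (q - 1) * t \<le> t powr q + (q - 1) * s powr q"
proof (cases "q = 1")
  case True
  then show ?thesis using assms by simp
next
  case False
  then have q: "1 < q" using assms by simp
  have "t * s powr (q - 1) \<le> t powr q / q + (s powr (q - 1)) powr (q / (q - 1)) / (q / (q - 1))"
    using q assms by (intro Youngs_inequality) (auto simp: field_simps)
  also have "(s powr (q - 1)) powr (q / (q - 1)) = s powr q"
    using q by (simp add: powr_powr)
  finally have "q * (t * s powr (q - 1)) \<le> q * (t powr q / q + s powr q / (q / (q - 1)))"
    using q by (intro mult_left_mono) auto
  also have "\<dots> = t powr q + (q - 1) * s powr q" using q by (simp add: field_simps)
  finally show ?thesis by (simp add: ac_simps)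
qed

section \<open>The lower bound\<close>

text \<open>On \<open>{a..<b}\<close> and off \<open>N\<close> the measure \<open>M\<close> is
  Lebesgue measure, recorded by \<open>lebesgue_part\<close> on half-open intervals; the single
  density \<open>F\<close> carries both parts of \<open>Df\<close>. The exponent lives on the whole
  line so that it can be integrated against \<open>M\<close> directly.\<close>

locale derivative_density =
  fixes a b P :: real and f p F :: "real \<Rightarrow> real" and M :: "real measure" and N :: "real set"
  assumes ab: "a < b"
    and finite_M: "finite_measure M" and sets_M: "sets M = sets borel"
    and conc_M: "AE x in M. x \<in> {a..<b}"
    and N_sets: "N \<in> sets borel" and F_meas: "F \<in> borel_measurable borel"
    and F_int: "integrable M F" and F_N: "\<And>x. x \<in> N \<Longrightarrow> \<bar>F x\<bar> = 1"
    and f_eq: "\<And>c d. a \<le> c \<Longrightarrow> c < d \<Longrightarrow> d \<le> b \<Longrightarrow> f d - f c = (LINT x:{c..<d}|M. F x)"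
    and lebesgue_part: "\<And>c d. a \<le> c \<Longrightarrow> c < d \<Longrightarrow> d \<le> b \<Longrightarrow> measure M ({c..<d} - N) = d - c"
    and p_cont: "continuous_on UNIV p" and p_ge: "\<And>x. 1 \<le> p x" and p_le: "\<And>x. p x \<le> P"
begin

sublocale finite_measure M by (rule finite_M)

lemma meas_M: "h \<in> borel_measurable borel \<Longrightarrow> h \<in> borel_measurable M"
  by (simp add: measurable_cong_sets[OF sets_M refl])

abbreviation \<phi> :: "real \<Rightarrow> real \<Rightarrow> ennreal" where "\<phi> x t \<equiv> ennreal (t powr p x)"

text \<open>The density of Lebesgue measure on \<open>{a..<b}\<close> with respect to
  \<open>M\<close>, as \<open>set_integral_E\<close> shows on intervals.\<close>

abbreviation E :: "real \<Rightarrow> real" where "E \<equiv> indicator (- N)"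

lemma E_meas: "E \<in> borel_measurable borel"
  using N_sets by measurable

lemma p_meas: "p \<in> borel_measurable borel"
  by (rule borel_measurable_continuous_onI[OF p_cont])

lemma E_int: "integrable M E"
  by (rule integrable_const_bound[of _ 1]) (auto intro: meas_M E_meas)

lemma bounded_mult_int:
  fixes h g :: "real \<Rightarrow> real"
  assumes "h \<in> borel_measurable borel" "\<And>x. \<bar>h x\<bar> \<le> B" "integrable M g"
  shows "integrable M (\<lambda>x. h x * g x)"
proof (rule Bochner_Integration.integrable_bound[where f="\<lambda>x. B * g x"])
  have "0 \<le> B" using assms(2)[of 0] by linarith
  then show "AE x in M. norm (h x * g x) \<le> norm (B * g x)"
    using assms(2) by (intro AE_I2) (simp add: abs_mult mult_right_mono)
  show "(\<lambda>x. h x * g x) \<in> borel_measurable M"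
    using meas_M[OF assms(1)] assms(3) by (intro borel_measurable_times) auto
qed (use assms in auto)

lemma set_int:
  fixes g :: "real \<Rightarrow> real"
  assumes "integrable M g"
  shows "set_integrable M {c..<d} g"
  unfolding set_integrable_def using assms by (intro integrable_mult_indicator) (auto simp: sets_M)

lemma set_integral_E:
  assumes "a \<le> c" "c < d" "d \<le> b"
  shows "(LINT x:{c..<d}|M. E x) = d - c"
proof -
  have "(LINT x:{c..<d}|M. E x) = (LINT x|M. indicator ({c..<d} - N) x)"
    unfolding set_lebesgue_integral_def
    by (intro Bochner_Integration.integral_cong) (auto simp: indicator_def)
  also have "\<dots> = measure M ({c..<d} - N)"
    using N_sets by (simp add: sets_M)
  finally show ?thesis using lebesgue_part[OF assms] by simp
qed

text \<open>The tangent at \<open>s\<close> bounds the power below by an expression linear in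
  \<open>\<bar>f d - f c\<bar>\<close>, and the factor \<open>\<sigma>\<close> in
  \<open>[-1, 1]\<close> removes the absolute value. The result is affine in the increment and can
  be written as an integral over the cell.\<close>

lemma riesz_term_ge:
  assumes cd: "a \<le> c" "c < d" "d \<le> b" and \<sigma>: "\<bar>\<sigma>\<bar> \<le> 1" and s: "0 < s"
  shows "(\<sigma> * p c * s powr (p c - 1)) * (f d - f c) - (p c - 1) * s powr p c * (d - c)
    \<le> (\<bar>f c - f d\<bar> / (d - c)) powr p c * (d - c)"
proof -
  define t where "t = \<bar>f c - f d\<bar> / (d - c)"
  have t: "0 \<le> t" "t * (d - c) = \<bar>f d - f c\<bar>" using cd by (auto simp: t_def)
  have "p c * s powr (p c - 1) * t - (p c - 1) * s powr p c \<le> t powr p c"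
    using young_powr[of t s "p c"] t(1) s p_ge[of c] by simp
  then have "(p c * s powr (p c - 1) * t - (p c - 1) * s powr p c) * (d - c) \<le> t powr p c * (d - c)"
    using cd by (intro mult_right_mono) auto
  moreover have "\<sigma> * (f d - f c) \<le> \<bar>f d - f c\<bar>"
    using mult_right_mono[OF \<sigma>, of "\<bar>f d - f c\<bar>"] by (simp flip: abs_mult)
  then have "(p c * s powr (p c - 1)) * (\<sigma> * (f d - f c)) \<le> (p c * s powr (p c - 1)) * (t * (d - c))"
    using p_ge[of c] t(2) by (intro mult_left_mono) auto
  ultimately show ?thesis by (simp add: t_def[symmetric] algebra_simps)
qed

lemma powr_bound:
  assumes "0 < x" "x \<le> h" "1 \<le> h" "q \<le> P" "0 \<le> q"
  shows "x powr q \<le> h powr P"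
proof -
  have "x powr q \<le> h powr q" using assms by (intro powr_mono2) auto
  also have "\<dots> \<le> h powr P" using assms by (intro powr_mono) auto
  finally show ?thesis .
qed

text \<open>Off \<open>N\<close> the maximum over \<open>\<sigma>\<close> and \<open>s\<close> is
  \<open>\<bar>F x\<bar> powr p x\<close>, reached at \<open>\<sigma> = sgn (F x)\<close> and
  \<open>s = \<bar>F x\<bar>\<close>. On \<open>N\<close> the subtracted term vanishes, and for
  \<open>p x > 1\<close> the values are unbounded in \<open>s\<close>.\<close>

definition dual_integrand :: "(real \<Rightarrow> real) \<Rightarrow> (real \<Rightarrow> real) \<Rightarrow> real \<Rightarrow> real" where
  "dual_integrand \<sigma> s x =
    \<sigma> x * p x * s x powr (p x - 1) * F x - (p x - 1) * s x powr p x * E x"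

lemma coefficient_bounds:
  assumes \<sigma>: "\<bar>\<sigma>\<bar> \<le> 1" and s: "0 < s" "s \<le> h" "1 \<le> h"
  shows "\<bar>\<sigma> * p x * s powr (p x - 1)\<bar> \<le> P * h powr P" "\<bar>(p x - 1) * s powr p x\<bar> \<le> P * h powr P"
proof -
  have 1: "s powr (p x - 1) \<le> h powr P" "s powr p x \<le> h powr P"
    using p_ge[of x] p_le[of x] s by (auto intro!: powr_bound)
  have "\<bar>\<sigma>\<bar> * p x \<le> 1 * P" using \<sigma> p_ge[of x] p_le[of x] by (intro mult_mono) auto
  then have "(\<bar>\<sigma>\<bar> * p x) * s powr (p x - 1) \<le> P * h powr P"
    using 1 p_ge[of x] p_le[of x] by (intro mult_mono) auto
  then show "\<bar>\<sigma> * p x * s powr (p x - 1)\<bar> \<le> P * h powr P"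
    using p_ge[of x] by (simp add: abs_mult)
  have "(p x - 1) * s powr p x \<le> P * h powr P"
    using 1 p_ge[of x] p_le[of x] by (intro mult_mono) auto
  then show "\<bar>(p x - 1) * s powr p x\<bar> \<le> P * h powr P"
    using p_ge[of x] by (simp add: abs_mult)
qed

lemma dual_integrand_meas:
  assumes "\<sigma> \<in> borel_measurable borel" "s \<in> borel_measurable borel"
  shows "dual_integrand \<sigma> s \<in> borel_measurable borel"
  unfolding dual_integrand_def using assms p_meas F_meas E_meas by measurable

lemma dual_integrand_int:
  assumes "\<sigma> \<in> borel_measurable borel" "s \<in> borel_measurable borel"
    and "\<And>x. \<bar>\<sigma> x\<bar> \<le> 1" "\<And>x. 0 < s x" "\<And>x. s x \<le> h" "1 \<le> h"
  shows "integrable M (dual_integrand \<sigma> s)"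
  unfolding dual_integrand_def
  using assms p_meas F_int E_int coefficient_bounds[of "\<sigma> _" "s _" h]
  by (intro Bochner_Integration.integrable_diff bounded_mult_int[where B="P * h powr P"]) auto

text \<open>Freezing the coefficients at the left endpoint of each cell makes
  \<open>riesz_term_ge\<close> applicable. Uniform continuity on \<open>{a..b}\<close> keeps the
  freezing error below \<open>e * (\<bar>F x\<bar> + E x)\<close>, whose integral is at most
  \<open>\<epsilon>\<close>.\<close>

lemma dual_integral_le_continuous:
  assumes \<sigma>: "continuous_on UNIV \<sigma>" "\<And>x. \<bar>\<sigma> x\<bar> \<le> 1"
    and s: "continuous_on UNIV s" "\<And>x. 0 < s x" "\<And>x. s x \<le> h0" "1 \<le> h0"
  shows "ennreal (LINT x|M. dual_integrand \<sigma> s x) \<le> riesz_variation \<phi> a b f"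
proof (rule ennreal_le_epsilon)
  fix \<epsilon> :: real assume \<epsilon>: "0 < \<epsilon>"
  define h where "h x = \<sigma> x * p x * s x powr (p x - 1)" for x
  define k where "k x = (p x - 1) * s x powr p x" for x
  have cont: "continuous_on UNIV h" "continuous_on UNIV k"
    unfolding h_def k_def using less_imp_neq[OF s(2), symmetric]
    by (auto intro!: continuous_intros \<sigma> s p_cont)
  have dual: "dual_integrand \<sigma> s x = h x * F x - k x * E x" for x
    by (simp add: dual_integrand_def h_def k_def)
  have hk: "h \<in> borel_measurable borel" "\<And>x. \<bar>h x\<bar> \<le> P * h0 powr P"
    "k \<in> borel_measurable borel" "\<And>x. \<bar>k x\<bar> \<le> P * h0 powr P"
    using borel_measurable_continuous_onI[OF cont(1)] borel_measurable_continuous_onI[OF cont(2)]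
      coefficient_bounds[OF \<sigma>(2) s(2-4)] by (auto simp: h_def k_def)
  define C where "C = (LINT x|M. \<bar>F x\<bar> + E x)"
  have C_int: "integrable M (\<lambda>x. \<bar>F x\<bar> + E x)" using F_int E_int by auto
  have C: "0 \<le> C" unfolding C_def by (intro integral_nonneg_AE AE_I2) auto
  define e where "e = \<epsilon> / (C + 1)"
  have e: "0 < e" "e * C \<le> \<epsilon>" using \<epsilon> C by (auto simp: e_def field_simps)
  have unif: "\<exists>\<delta>>0. \<forall>x\<in>{a..b}. \<forall>y\<in>{a..b}. dist y x < \<delta> \<longrightarrow> dist (g y) (g x) < e"
    if "continuous_on UNIV g" for g :: "real \<Rightarrow> real"
    using compact_uniformly_continuous[OF continuous_on_subset[OF that] compact_Icc, of a b] e(1)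
    unfolding uniformly_continuous_on_def by blast
  obtain \<delta>1 where \<delta>1: "0 < \<delta>1" "\<And>x y. x \<in> {a..b} \<Longrightarrow> y \<in> {a..b} \<Longrightarrow> dist y x < \<delta>1 \<Longrightarrow> dist (h y) (h x) < e"
    using unif[OF cont(1)] by blast
  obtain \<delta>2 where \<delta>2: "0 < \<delta>2" "\<And>x y. x \<in> {a..b} \<Longrightarrow> y \<in> {a..b} \<Longrightarrow> dist y x < \<delta>2 \<Longrightarrow> dist (k y) (k x) < e"
    using unif[OF cont(2)] by blast
  define I where "I = (LINT x|M. dual_integrand \<sigma> s x)"
  define u where "u x = h x * F x - k x * E x - e * (\<bar>F x\<bar> + E x)" for x
  have hF_int: "integrable M (\<lambda>x. h x * F x)" "integrable M (\<lambda>x. k x * E x)"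
    using bounded_mult_int hk F_int E_int by blast+
  have u_int: "integrable M u"
    unfolding u_def using hF_int C_int by auto
  have u_I: "(LINT x|M. u x) = I - e * C"
    unfolding u_def I_def C_def dual using hF_int F_int E_int by simp
  have "ennreal (I - e * C) \<le> riesz_variation \<phi> a b f"
  proof (rule riesz_variation_ge[OF ab])
    show "0 < min \<delta>1 \<delta>2" using \<delta>1 \<delta>2 by simp
    fix D assume D: "interval_partition a b D" and mesh: "mesh D < min \<delta>1 \<delta>2"
    have "(LINT x|M. u x) = (\<Sum>K\<in>D. LINT x:{Inf K..<Sup K}|M. u x)"
      by (rule interval_partition_sum_integral[OF D sets_M conc_M u_int, symmetric])
    also have "\<dots> \<le> (\<Sum>K\<in>D. (\<bar>f (Inf K) - f (Sup K)\<bar> / measure lborel K) powr p (Inf K) * measure lborel K)"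
    proof (rule sum_mono)
      fix K assume K: "K \<in> D"
      define c where "c = Inf K"
      define d where "d = Sup K"
      have cd: "a \<le> c" "c < d" "d \<le> b" "measure lborel K = d - c"
        using interval_partition_elem[OF D K] by (auto simp: c_def d_def)
      have dc: "d - c < \<delta>1" "d - c < \<delta>2"
        using measure_le_mesh[OF D K] mesh cd(4) by auto
      have "(LINT x:{c..<d}|M. u x) \<le> (LINT x:{c..<d}|M. h c * F x - k c * E x)"
      proof (rule set_integral_mono)
        show "set_integrable M {c..<d} u" by (rule set_int[OF u_int])
        show "set_integrable M {c..<d} (\<lambda>x. h c * F x - k c * E x)"
          using F_int E_int by (intro set_int) auto
        fix x assume x: "x \<in> {c..<d}"
        have "\<bar>h x - h c\<bar> < e" "\<bar>k x - k c\<bar> < e"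
          using \<delta>1(2)[of c x] \<delta>2(2)[of c x] x cd dc by (auto simp: dist_real_def)
        then have "\<bar>h x - h c\<bar> * \<bar>F x\<bar> \<le> e * \<bar>F x\<bar>" "\<bar>k x - k c\<bar> * E x \<le> e * E x"
          by (auto intro!: mult_right_mono)
        moreover have "(h x - h c) * F x \<le> \<bar>h x - h c\<bar> * \<bar>F x\<bar>" by (simp flip: abs_mult)
        moreover have "- (k x - k c) * E x \<le> \<bar>k x - k c\<bar> * E x" by (intro mult_right_mono) auto
        ultimately show "u x \<le> h c * F x - k c * E x" by (simp add: u_def algebra_simps)
      qed
      also have "\<dots> = h c * (f d - f c) - k c * (d - c)"
        using set_int[OF F_int] set_int[OF E_int] f_eq[OF cd(1-3)] set_integral_E[OF cd(1-3)]
        by simp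
      also have "\<dots> \<le> (\<bar>f c - f d\<bar> / (d - c)) powr p c * (d - c)"
        using riesz_term_ge[OF cd(1-3) \<sigma>(2) s(2)] unfolding h_def k_def by simp
      finally show "(LINT x:{Inf K..<Sup K}|M. u x) \<le>
          (\<bar>f (Inf K) - f (Sup K)\<bar> / measure lborel K) powr p (Inf K) * measure lborel K"
        using cd(4) by (simp add: c_def d_def)
    qed
    finally have "ennreal (I - e * C) \<le>
        ennreal (\<Sum>K\<in>D. (\<bar>f (Inf K) - f (Sup K)\<bar> / measure lborel K) powr p (Inf K) * measure lborel K)"
      unfolding u_I by (rule ennreal_leI)
    also have "\<dots> = (\<Sum>K\<in>D. ennreal ((\<bar>f (Inf K) - f (Sup K)\<bar> / measure lborel K) powr p (Inf K)) * ennreal (measure lborel K))"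
      by (simp add: sum_ennreal[symmetric] ennreal_mult)
    also have "\<dots> \<le> riesz_sum \<phi> f D"
      unfolding riesz_sum_def
    proof (intro sum_mono mult_right_mono)
      fix K assume K: "K \<in> D"
      have "Inf K \<in> {Inf K..Sup K}" using interval_partition_elem(3)[OF D K] by simp
      then have "Inf K \<in> K" using interval_partition_elem(1)[OF D K] by simp
      then show "\<phi> (Inf K) (\<bar>f (Inf K) - f (Sup K)\<bar> / measure lborel K)
          \<le> phi_plus \<phi> K (\<bar>f (Inf K) - f (Sup K)\<bar> / measure lborel K)"
        unfolding phi_plus_def by (intro SUP_upper)
    qed simp
    finally show "ennreal (I - e * C) \<le> riesz_sum \<phi> f D" .
  qed
  then have "ennreal (I - e * C) + ennreal \<epsilon> \<le> riesz_variation \<phi> a b f + ennreal \<epsilon>"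
    by (rule add_right_mono)
  \<comment> \<open>If \<open>I - e * C\<close> is negative, its \<open>ennreal\<close> value is 0,
    but then \<open>I \<le> e * C \<le> \<epsilon>\<close>.\<close>
  moreover have "ennreal I \<le> ennreal (I - e * C) + ennreal \<epsilon>"
    using e \<epsilon> ennreal_leI[of I "(I - e * C) + \<epsilon>"] ennreal_plus_if[of "I - e * C" \<epsilon>]
    by (auto simp: ennreal_plus_if intro: order_trans ennreal_leI split: if_splits)
  ultimately show "ennreal (LINT x|M. dual_integrand \<sigma> s x) \<le> riesz_variation \<phi> a b f + ennreal \<epsilon>"
    unfolding I_def by (rule order_trans[rotated])
qed

text \<open>Continuous approximants with the same bounds keep the base of \<open>powr\<close> away
  from 0, where convergence could fail, and have a common integrable majorant.\<close>

lemma dual_integral_le: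
  assumes \<sigma>: "\<sigma> \<in> borel_measurable borel" "\<And>x. \<bar>\<sigma> x\<bar> \<le> 1"
    and s: "s \<in> borel_measurable borel" "0 < lo" "\<And>x. lo \<le> s x" "\<And>x. s x \<le> hi" "1 \<le> hi"
  shows "ennreal (LINT x|M. dual_integrand \<sigma> s x) \<le> riesz_variation \<phi> a b f"
proof -
  have "\<And>x. - 1 \<le> \<sigma> x" "\<And>x. \<sigma> x \<le> 1" using \<sigma>(2) by (auto simp: abs_le_iff minus_le_iff)
  then obtain \<tau> where \<tau>: "\<And>n::nat. continuous_on UNIV (\<tau> n)" "\<And>n x. -1 \<le> \<tau> n x" "\<And>n x. \<tau> n x \<le> 1"
    "AE x in M. (\<lambda>n. \<tau> n x) \<longlonglongrightarrow> \<sigma> x"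
    using continuous_AE_approx[OF finite_M sets_M \<sigma>(1)] by blast
  obtain g where g: "\<And>n::nat. continuous_on UNIV (g n)" "\<And>n x. lo \<le> g n x" "\<And>n x. g n x \<le> hi"
    "AE x in M. (\<lambda>n. g n x) \<longlonglongrightarrow> s x"
    using continuous_AE_approx[OF finite_M sets_M s(1,3,4)] by blast
  have \<tau>1: "\<bar>\<tau> n x\<bar> \<le> 1" for n x using \<tau>(2)[of n x] \<tau>(3)[of n x] by linarith
  have g0: "0 < g n x" for n x using g(2)[of n x] s(2) by linarith
  have s0: "0 < s x" for x using s(3)[of x] s(2) by linarith
  have meas: "dual_integrand (\<tau> n) (g n) \<in> borel_measurable M" for n
    by (intro meas_M dual_integrand_meas borel_measurable_continuous_onI \<tau> g)
  have "(\<lambda>n. LINT x|M. dual_integrand (\<tau> n) (g n) x) \<longlonglongrightarrow> (LINT x|M. dual_integrand \<sigma> s x)"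
  proof (rule integral_dominated_convergence[where w="\<lambda>x. P * hi powr P * (\<bar>F x\<bar> + E x)"])
    show "dual_integrand \<sigma> s \<in> borel_measurable M" using \<sigma> s by (intro meas_M dual_integrand_meas)
    show "dual_integrand (\<tau> n) (g n) \<in> borel_measurable M" for n by (rule meas)
    show "integrable M (\<lambda>x. P * hi powr P * (\<bar>F x\<bar> + E x))" using F_int E_int by auto
    show "AE x in M. (\<lambda>n. dual_integrand (\<tau> n) (g n) x) \<longlonglongrightarrow> dual_integrand \<sigma> s x"
      using \<tau>(4) g(4)
    proof eventually_elim
      case (elim x)
      have "s x \<noteq> 0" using s0[of x] by simp
      then show ?case unfolding dual_integrand_def by (intro tendsto_intros elim) auto
    qed
    show "AE x in M. norm (dual_integrand (\<tau> n) (g n) x) \<le> P * hi powr P * (\<bar>F x\<bar> + E x)" for n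
    proof (rule AE_I2)
      fix x
      let ?h = "\<tau> n x * p x * g n x powr (p x - 1)" and ?k = "(p x - 1) * g n x powr p x"
      have "\<bar>?h * F x - ?k * E x\<bar> \<le> \<bar>?h\<bar> * \<bar>F x\<bar> + \<bar>?k\<bar> * E x"
        using abs_triangle_ineq4[of "?h * F x" "?k * E x"] by (simp add: abs_mult)
      also have "\<dots> \<le> P * hi powr P * \<bar>F x\<bar> + P * hi powr P * E x"
        using coefficient_bounds[OF \<tau>1 g0 g(3) s(5)] by (intro add_mono mult_right_mono) auto
      finally show "norm (dual_integrand (\<tau> n) (g n) x) \<le> P * hi powr P * (\<bar>F x\<bar> + E x)"
        unfolding dual_integrand_def real_norm_def by (simp add: algebra_simps)
    qed
  qed
  then have "(\<lambda>n. ennreal (LINT x|M. dual_integrand (\<tau> n) (g n) x)) \<longlonglongrightarrow> ennreal (LINT x|M. dual_integrand \<sigma> s x)"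
    by (rule tendsto_ennrealI)
  moreover have "ennreal (LINT x|M. dual_integrand (\<tau> n) (g n) x) \<le> riesz_variation \<phi> a b f" for n
    by (rule dual_integral_le_continuous[OF \<tau>(1) \<tau>1 g(1) g0 g(3) s(5)])
  ultimately show ?thesis by (intro LIMSEQ_le_const2) auto
qed

section \<open>Truncated test functions and Fatou's lemma\<close>

lemma P_ge: "1 \<le> P"
  using p_ge[of 0] p_le[of 0] by linarith

text \<open>The pointwise limit of the truncated integrands, extended-valued because of
  \<open>N\<close>.\<close>

definition lower_density :: "real \<Rightarrow> ennreal" where
  "lower_density x = (if x \<in> N then (if p x = 1 then 1 else \<infinity>) else ennreal (\<bar>F x\<bar> powr p x))"

text \<open>The level \<open>1 / R\<close> supplies the positive lower bound that
  \<open>dual_integral_le\<close> demands. On \<open>N\<close> only growth matters, so the largest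
  admissible value is taken.\<close>

definition cutoff :: "real \<Rightarrow> real \<Rightarrow> real" where
  "cutoff R x = (if x \<in> N then R else max (1 / R) (min R \<bar>F x\<bar>))"

lemma cutoff_bounds:
  assumes "1 \<le> R"
  shows "1 / R \<le> cutoff R x" "cutoff R x \<le> R"
proof -
  have "1 / R \<le> R" using assms by (smt (verit) divide_le_eq_1)
  then show "1 / R \<le> cutoff R x" "cutoff R x \<le> R" by (auto simp: cutoff_def)
qed

lemma cutoff_meas: "cutoff R \<in> borel_measurable borel"
  unfolding cutoff_def using N_sets F_meas by measurable

abbreviation truncated :: "real \<Rightarrow> real \<Rightarrow> real" where
  "truncated R \<equiv> dual_integrand (\<lambda>x. sgn (F x)) (cutoff R)"

lemma truncated_N:
  assumes "x \<in> N"
  shows "truncated R x = p x * R powr (p x - 1)"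
proof -
  have "sgn (F x) * F x = 1" using F_N[OF assms] by (metis abs_sgn mult.commute)
  then show ?thesis
    using assms by (simp add: dual_integrand_def cutoff_def mult.assoc mult.left_commute)
qed

lemma truncated_not_N:
  assumes "x \<notin> N" "1 \<le> R"
  shows "truncated R x = cutoff R x powr (p x - 1) * (p x * \<bar>F x\<bar> - (p x - 1) * cutoff R x)"
proof -
  have "0 < 1 / R" using assms by simp
  then have "0 < cutoff R x" using cutoff_bounds(1)[OF assms(2)] by (rule less_le_trans)
  then have "cutoff R x powr p x = cutoff R x powr (p x - 1) * cutoff R x"
    by (simp add: powr_diff)
  moreover have "F x * sgn (F x) = \<bar>F x\<bar>" by (simp add: abs_sgn)
  ultimately show ?thesis
    using assms by (simp add: dual_integrand_def algebra_simps)
qed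

text \<open>Fatou's lemma needs nonnegative functions. Negative values occur only off
  \<open>N\<close> where \<open>\<bar>F x\<bar> < 1 / R\<close>: there the cutoff exceeds the
  optimal \<open>\<bar>F x\<bar>\<close>, but the subtracted term is at most
  \<open>P / R\<close>.\<close>

lemma truncated_ge:
  assumes "1 \<le> R"
  shows "- (P / R) \<le> truncated R x"
proof (cases "x \<in> N")
  case True
  have "0 \<le> p x * R powr (p x - 1)" using p_ge[of x] by simp
  moreover have "0 \<le> P / R" using P_ge assms by simp
  ultimately show ?thesis using truncated_N[OF True] by simp
next
  case False
  have R: "0 < 1 / R" "1 / R \<le> 1" using assms by auto
  show ?thesis
  proof (cases "\<bar>F x\<bar> < 1 / R")
    case True
    then have c: "cutoff R x = 1 / R"
      using False R assms by (simp add: cutoff_def)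
    have "(p x - 1) * (1 / R) \<le> P * (1 / R)" using p_le[of x] R by (intro mult_right_mono) auto
    moreover have "0 \<le> p x * \<bar>F x\<bar>" using p_ge[of x] by simp
    ultimately have "- (P / R) \<le> p x * \<bar>F x\<bar> - (p x - 1) * (1 / R)" by simp
    then have "(1 / R) powr (p x - 1) * - (P / R) \<le> (1 / R) powr (p x - 1) * (p x * \<bar>F x\<bar> - (p x - 1) * (1 / R))"
      by (intro mult_left_mono) auto
    moreover have "(1 / R) powr (p x - 1) \<le> 1"
      using R p_ge[of x] by (intro powr_le1) auto
    then have "(1 / R) powr (p x - 1) * (P / R) \<le> 1 * (P / R)"
      using P_ge R assms by (intro mult_right_mono) auto
    ultimately show ?thesis using truncated_not_N[OF False assms] c by simp
  next
    case Fx: False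
    then have c: "cutoff R x \<le> \<bar>F x\<bar>" using False by (simp add: cutoff_def)
    have "0 < cutoff R x" using R cutoff_bounds(1)[OF assms, of x] by linarith
    have "(p x - 1) * cutoff R x \<le> p x * \<bar>F x\<bar>"
      using c p_ge[of x] \<open>0 < cutoff R x\<close> by (intro mult_mono) auto
    then have "0 \<le> truncated R x" using truncated_not_N[OF False assms] by simp
    moreover have "0 \<le> P / R" using P_ge assms by simp
    ultimately show ?thesis by simp
  qed
qed

text \<open>Off \<open>N\<close> with \<open>F x \<noteq> 0\<close> the cutoff eventually equals
  \<open>\<bar>F x\<bar>\<close>, where the tangent touches the power, so the truncated value is
  exact. With \<open>F x = 0\<close> it is squeezed between \<open>- (P / R)\<close> and 0. On
  \<open>N\<close> it is \<open>p x * R powr (p x - 1)\<close>, which is 1 or diverges.\<close>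

lemma truncated_tendsto:
  "(\<lambda>n. ennreal (truncated (real (Suc n)) x + P / real (Suc n))) \<longlonglongrightarrow> lower_density x"
proof -
  have PR: "(\<lambda>n. P / real (Suc n)) \<longlonglongrightarrow> 0"
    using LIMSEQ_Suc[OF lim_const_over_n[of P]] by simp
  show ?thesis
  proof (cases "x \<in> N")
    case True
    show ?thesis
    proof (cases "p x = 1")
      case p1: True
      have "(\<lambda>n. 1 + P / real (Suc n)) \<longlonglongrightarrow> 1 + 0" by (intro tendsto_intros PR)
      then have "(\<lambda>n. ennreal (1 + P / real (Suc n))) \<longlonglongrightarrow> ennreal 1"
        by (intro tendsto_ennrealI) simp
      then show ?thesis using True p1 by (simp add: truncated_N lower_density_def)
    next
      case False
      then have "0 < p x - 1" using p_ge[of x] by simp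
      then have "filterlim (\<lambda>n. exp ((p x - 1) * ln (real (Suc n)))) at_top sequentially"
        by (intro filterlim_compose[OF exp_at_top] filterlim_tendsto_pos_mult_at_top[OF tendsto_const]
          filterlim_compose[OF ln_at_top] filterlim_compose[OF filterlim_real_sequentially filterlim_Suc])
      then have "filterlim (\<lambda>n. real (Suc n) powr (p x - 1)) at_top sequentially"
        by (simp add: powr_def)
      then have "filterlim (\<lambda>n. truncated (real (Suc n)) x + P / real (Suc n)) at_top sequentially"
      proof (rule filterlim_at_top_mono)
        show "\<forall>\<^sub>F n in sequentially. real (Suc n) powr (p x - 1) \<le> truncated (real (Suc n)) x + P / real (Suc n)"
        proof (intro always_eventually allI)
          fix n
          have "1 * real (Suc n) powr (p x - 1) \<le> p x * real (Suc n) powr (p x - 1)"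
            using p_ge[of x] by (intro mult_right_mono) auto
          moreover have "0 \<le> P / real (Suc n)" using P_ge by simp
          ultimately show "real (Suc n) powr (p x - 1) \<le> truncated (real (Suc n)) x + P / real (Suc n)"
            unfolding truncated_N[OF True] by linarith
        qed
      qed
      then have "(\<lambda>n. ennreal (truncated (real (Suc n)) x + P / real (Suc n))) \<longlonglongrightarrow> top"
        unfolding ennreal_tendsto_top_eq_at_top .
      then show ?thesis using True False by (simp add: lower_density_def)
    qed
  next
    case False
    have "(\<lambda>n. truncated (real (Suc n)) x) \<longlonglongrightarrow> \<bar>F x\<bar> powr p x"
    proof (cases "F x = 0")
      case F0: True
      have up: "truncated (real (Suc n)) x \<le> 0" for n
        using F0 False p_ge[of x] cutoff_bounds(1)[of "real (Suc n)" x]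
        by (simp add: truncated_not_N mult_nonneg_nonneg order_trans[of 0 "1 / real (Suc n)"])
      have "(\<lambda>n. truncated (real (Suc n)) x) \<longlonglongrightarrow> 0"
      proof (rule tendsto_sandwich[where f="\<lambda>n. - (P / real (Suc n))" and h="\<lambda>_. 0"])
        show "(\<lambda>n. - (P / real (Suc n))) \<longlonglongrightarrow> 0" using tendsto_minus[OF PR] by simp
        show "\<forall>\<^sub>F n in sequentially. - (P / real (Suc n)) \<le> truncated (real (Suc n)) x"
          using truncated_ge by (intro always_eventually allI) simp
        show "\<forall>\<^sub>F n in sequentially. truncated (real (Suc n)) x \<le> 0"
          using up by (intro always_eventually allI)
      qed auto
      then show ?thesis using F0 by simp
    next
      case F0: False
      obtain n1 :: nat where n1: "\<bar>F x\<bar> \<le> real n1" using real_arch_simple by blast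
      obtain n2 where n2: "1 / real (Suc n2) < \<bar>F x\<bar>"
        using F0 reals_Archimedean[of "\<bar>F x\<bar>"] by (auto simp: inverse_eq_divide)
      have "truncated (real (Suc n)) x = \<bar>F x\<bar> powr p x" if "max n1 n2 \<le> n" for n
      proof -
        have "1 / real (Suc n) \<le> 1 / real (Suc n2)" using that by (intro divide_left_mono) auto
        moreover have "real n1 \<le> real (Suc n)" using that by simp
        ultimately have c: "cutoff (real (Suc n)) x = \<bar>F x\<bar>"
          using n1 n2 False by (simp add: cutoff_def)
        have "truncated (real (Suc n)) x = \<bar>F x\<bar> powr (p x - 1) * \<bar>F x\<bar>"
          using truncated_not_N[OF False, of "real (Suc n)"] unfolding c by (simp add: algebra_simps)
        also have "\<dots> = \<bar>F x\<bar> powr p x" using F0 by (simp add: powr_diff)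
        finally show ?thesis .
      qed
      then show ?thesis
        by (intro tendsto_eventually eventually_sequentiallyI[of "max n1 n2"])
    qed
    then have "(\<lambda>n. truncated (real (Suc n)) x + P / real (Suc n)) \<longlonglongrightarrow> \<bar>F x\<bar> powr p x + 0"
      by (intro tendsto_add PR)
    then show ?thesis using False by (simp add: lower_density_def tendsto_ennrealI)
  qed
qed

text \<open>The shift that ensures nonnegativity costs \<open>P * C / R\<close>, with
  \<open>C\<close> the total mass, and vanishes in the limit. Fatou's lemma admits the limit
  \<open>\<infinity>\<close> on \<open>N\<close>, where dominated convergence would fail.\<close>

theorem nn_integral_lower_density_le:
  "(\<integral>\<^sup>+x. lower_density x \<partial>M) \<le> riesz_variation \<phi> a b f"
proof -
  define V where "V = riesz_variation \<phi> a b f"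
  define C where "C = measure M (space M)"
  define u where "u n x = truncated (real (Suc n)) x + P / real (Suc n)" for n x
  have sg: "(\<lambda>x. sgn (F x)) \<in> borel_measurable borel" "\<And>x. \<bar>sgn (F x)\<bar> \<le> 1"
    using F_meas by (auto simp: abs_sgn_eq)
  have cut: "0 < cutoff (real (Suc n)) x" for n x
    using cutoff_bounds(1)[of "real (Suc n)" x] by (simp add: less_le_trans[of 0 "1 / real (Suc n)"])
  have trunc_int: "integrable M (truncated (real (Suc n)))" for n
    by (rule dual_integrand_int[OF sg(1) cutoff_meas sg(2) cut cutoff_bounds(2)]) auto
  have u_int: "integrable M (u n)" for n
    unfolding u_def using trunc_int by auto
  have u_nonneg: "0 \<le> u n x" for n x
    using truncated_ge[of "real (Suc n)" x] by (simp add: u_def)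
  have bound: "(\<integral>\<^sup>+x. ennreal (u n x) \<partial>M) \<le> V + ennreal (P * C / real (Suc n))" for n
  proof -
    have "(\<integral>\<^sup>+x. ennreal (u n x) \<partial>M) = ennreal (LINT x|M. u n x)"
      using u_int u_nonneg by (intro nn_integral_eq_integral) auto
    also have "(LINT x|M. u n x) = (LINT x|M. truncated (real (Suc n)) x) + P * C / real (Suc n)"
      unfolding u_def C_def using trunc_int[of n] by simp
    \<comment> \<open>Only an inequality: the integral of \<open>truncated\<close> may be negative,
      and \<open>ennreal\<close> sends it to 0.\<close>
    also have "ennreal \<dots> \<le> ennreal (LINT x|M. truncated (real (Suc n)) x) + ennreal (P * C / real (Suc n))"
      using P_ge by (auto simp: ennreal_plus_if C_def intro!: ennreal_leI)
    also have "ennreal (LINT x|M. truncated (real (Suc n)) x) \<le> V"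
      unfolding V_def
    proof (rule dual_integral_le[OF sg cutoff_meas, where lo="1 / real (Suc n)" and hi="real (Suc n)"])
      show "1 / real (Suc n) \<le> cutoff (real (Suc n)) x" "cutoff (real (Suc n)) x \<le> real (Suc n)" for x
        by (intro cutoff_bounds; simp)+
    qed auto
    finally show ?thesis by (simp add: add_right_mono)
  qed
  have lim: "lower_density x = liminf (\<lambda>n. ennreal (u n x))" for x
    using lim_imp_Liminf[OF _ truncated_tendsto[of x]] by (simp add: u_def)
  have "(\<integral>\<^sup>+x. lower_density x \<partial>M) \<le> liminf (\<lambda>n. \<integral>\<^sup>+x. ennreal (u n x) \<partial>M)"
    unfolding lim using u_int by (intro nn_integral_liminf) auto
  also have "\<dots> \<le> liminf (\<lambda>n. V + ennreal (P * C / real (Suc n)))"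
    using bound by (intro Liminf_mono always_eventually allI)
  also have "\<dots> = V + ennreal 0"
  proof (rule lim_imp_Liminf)
    have "(\<lambda>n. P * C / real (Suc n)) \<longlonglongrightarrow> 0"
      using LIMSEQ_Suc[OF lim_const_over_n[of "P * C"]] by simp
    then show "(\<lambda>n. V + ennreal (P * C / real (Suc n))) \<longlonglongrightarrow> V + ennreal 0"
      by (intro tendsto_add tendsto_const tendsto_ennrealI)
  qed simp
  finally show ?thesis unfolding V_def by simp
qed
end

section \<open>The upper bound\<close>

text \<open>For \<open>0 < u < 1\<close>, \<open>exp y \<ge> 1 + y\<close> gives
  \<open>1 - u powr (r - q) \<le> (r - q) * - ln u\<close>, and \<open>- ln u \<le> 1 / u\<close>.
  The factor \<open>u powr q \<le> u\<close> cancels \<open>1 / u\<close>; this is where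
  \<open>1 \<le> q\<close> enters.\<close>

lemma powr_le_powr_add:
  fixes u q r :: real
  assumes "0 \<le> u" "1 \<le> q" "q \<le> r"
  shows "u powr q \<le> u powr r + (r - q)"
proof (cases "u = 0 \<or> 1 \<le> u")
  case True
  then show ?thesis using assms powr_mono[of q r u] by auto
next
  case False
  then have u: "0 < u" "u < 1" using assms(1) by auto
  have "1 + (r - q) * ln u \<le> u powr (r - q)"
    using exp_ge_add_one_self[of "(r - q) * ln u"] u by (simp add: powr_def)
  moreover have "- ln u \<le> 1 / u"
    using ln_le_minus_one[of "1 / u"] u by (simp add: ln_div)
  then have "(r - q) * - ln u \<le> (r - q) * (1 / u)" using assms by (intro mult_left_mono) auto
  ultimately have "1 - u powr (r - q) \<le> (r - q) / u" by simp
  then have "u powr q * (1 - u powr (r - q)) \<le> u powr q * ((r - q) / u)"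
    by (intro mult_left_mono) auto
  also have "\<dots> \<le> u powr 1 * ((r - q) / u)"
    using u assms by (intro mult_right_mono powr_mono') auto
  also have "\<dots> = r - q" using u by simp
  finally have "u powr q - u powr q * u powr (r - q) \<le> r - q" by (simp add: algebra_simps)
  then show ?thesis by (simp flip: powr_add)
qed

context derivative_density
begin

text \<open>A real-valued counterpart of \<open>lower_density\<close>, equal to it except where
  \<open>x \<in> N\<close> and \<open>p x > 1\<close>.\<close>

definition upper_density :: "real \<Rightarrow> real" where
  "upper_density x = (if x \<in> N then 1 else \<bar>F x\<bar> powr p x)"

text \<open>The total variation of \<open>Df\<close> on the cell per unit of Lebesgue length,
  singular mass included.\<close>

abbreviation mean_slope :: "real \<Rightarrow> real \<Rightarrow> real" where
  "mean_slope c d \<equiv> (LINT x:{c..<d}|M. \<bar>F x\<bar>) / (d - c)"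

text \<open>A Jensen inequality in which singular mass counts in the mean \<open>t\<close> but not
  in the length. The tangent at \<open>t\<close> is integrated: off \<open>N\<close> it is Young's
  inequality followed by \<open>powr_le_powr_add\<close>; at almost every point of \<open>N\<close>,
  \<open>q \<le> p x = 1\<close> forces \<open>q = 1\<close>. As \<open>t * (d - c)\<close> is the
  integral of \<open>\<bar>F x\<bar>\<close>, the linear term integrates to
  \<open>q * t powr q * (d - c)\<close>.\<close>

lemma mean_slope_powr_le:
  assumes G: "integrable M upper_density" and null: "AE x in M. x \<in> N \<longrightarrow> p x = 1"
    and cd: "a \<le> c" "c < d" "d \<le> b" and q: "1 \<le> q"
    and pq: "\<And>x. x \<in> {c..d} \<Longrightarrow> q \<le> p x" "\<And>x. x \<in> {c..d} \<Longrightarrow> p x \<le> q + \<eta>"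
  shows "mean_slope c d powr q * (d - c) \<le> (LINT x:{c..<d}|M. upper_density x + \<eta> * E x)"
proof -
  define t where "t = mean_slope c d"
  have abs_int: "integrable M (\<lambda>x. \<bar>F x\<bar>)" using F_int by simp
  have "0 \<le> (LINT x:{c..<d}|M. \<bar>F x\<bar>)"
    unfolding set_lebesgue_integral_def by (intro integral_nonneg_AE AE_I2) auto
  then have t: "0 \<le> t" "t * (d - c) = (LINT x:{c..<d}|M. \<bar>F x\<bar>)" using cd by (auto simp: t_def)
  have tq: "t powr (q - 1) * t = t powr q"
    using t(1) q by (cases "t = 0") (auto simp: powr_diff)
  have ints: "integrable M (\<lambda>x. (q * t powr (q - 1)) * \<bar>F x\<bar>)" "integrable M (\<lambda>x. upper_density x + \<eta> * E x)"
     "integrable M (\<lambda>x. ((q - 1) * t powr q) * E x)"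
    using abs_int G E_int by auto
  have "(LINT x:{c..<d}|M. (q * t powr (q - 1)) * \<bar>F x\<bar>)
      \<le> (LINT x:{c..<d}|M. (upper_density x + \<eta> * E x) + ((q - 1) * t powr q) * E x)"
  proof (rule set_integral_mono_AE)
    show "set_integrable M {c..<d} (\<lambda>x. (q * t powr (q - 1)) * \<bar>F x\<bar>)"
      by (rule set_int[OF ints(1)])
    show "set_integrable M {c..<d} (\<lambda>x. (upper_density x + \<eta> * E x) + ((q - 1) * t powr q) * E x)"
      using Bochner_Integration.integrable_add[OF ints(2,3)] by (rule set_int)
    show "AE x\<in>{c..<d} in M. (q * t powr (q - 1)) * \<bar>F x\<bar> \<le> (upper_density x + \<eta> * E x) + ((q - 1) * t powr q) * E x"
      using null
    proof eventually_elim
      case (elim x)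
      show ?case
      proof
        assume x: "x \<in> {c..<d}"
        then have px: "q \<le> p x" "p x \<le> q + \<eta>" using pq by auto
        show "(q * t powr (q - 1)) * \<bar>F x\<bar> \<le> (upper_density x + \<eta> * E x) + ((q - 1) * t powr q) * E x"
        proof (cases "x \<in> N")
          case True
          then have "q = 1" using elim px q by simp
          \<comment> \<open>Since \<open>0 powr 0 = 0\<close>, the factor
            \<open>t powr (q - 1)\<close> is 0 or 1 here.\<close>
          then show ?thesis using True F_N[OF True] by (simp add: upper_density_def powr_zero_eq_one split: if_splits)
        next
          case False
          have "q * t powr (q - 1) * \<bar>F x\<bar> \<le> \<bar>F x\<bar> powr q + (q - 1) * t powr q"
            using t(1) q by (intro young_powr) auto
          also have "\<bar>F x\<bar> powr q \<le> \<bar>F x\<bar> powr p x + (p x - q)"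
            using px q by (intro powr_le_powr_add) auto
          finally show ?thesis using False px by (simp add: upper_density_def)
        qed
      qed
    qed
  qed
  also have "\<dots> = (LINT x:{c..<d}|M. upper_density x + \<eta> * E x) + (q - 1) * t powr q * (d - c)"
    using set_int[OF ints(2), of c d] set_int[OF ints(3), of c d] set_integral_E[OF cd]
    by (subst set_integral_add) auto
  finally have "q * (t powr (q - 1) * t) * (d - c)
      \<le> (LINT x:{c..<d}|M. upper_density x + \<eta> * E x) + (q - 1) * t powr q * (d - c)"
    using t(2) by (simp add: mult.assoc)
  then show ?thesis unfolding tq t_def[symmetric] by (simp add: algebra_simps)
qed

text \<open>The constant that, divided by \<open>d - c\<close>, bounds every mean slope; the maximum
  with 1 makes its logarithm nonnegative.\<close>

definition slope_bound :: real where
  "slope_bound = max 1 (LINT x|M. \<bar>F x\<bar>)"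

text \<open>The logarithm in the Hoelder condition absorbs the a priori bound \<open>slope_bound / (d - c)\<close>
  for difference quotients, so that exponents may be exchanged at the cost of a factor near 1.\<close>
lemma phi_plus_term_le:
  assumes cd: "a \<le> c" "c < d" "d \<le> b" and q: "1 \<le> q" and \<eta>: "0 \<le> \<eta>"
    and pq: "\<And>x. x \<in> {c..d} \<Longrightarrow> q \<le> p x"
    "\<And>x. x \<in> {c..d} \<Longrightarrow> (p x - q) * ln (exp 1 + 1 / (d - c)) \<le> \<eta>"
    and x: "x \<in> {c..d}"
  shows "(\<bar>f c - f d\<bar> / (d - c)) powr p x
    \<le> exp (\<eta> * (1 + ln slope_bound)) * mean_slope c d powr q"
proof -
  define t where "t = mean_slope c d"
  define r where "r = p x - q"
  define L where "L = ln (exp 1 + 1 / (d - c))"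
  have "\<bar>f d - f c\<bar> \<le> (LINT x:{c..<d}|M. \<bar>F x\<bar>)"
    using set_integral_norm_bound[OF set_int[OF F_int, of c d]] f_eq[OF cd] by simp
  then have ft: "\<bar>f c - f d\<bar> / (d - c) \<le> t"
    using cd by (auto simp: t_def abs_minus_commute intro: divide_right_mono)
  moreover have "0 \<le> \<bar>f c - f d\<bar> / (d - c)" using cd by simp
  ultimately have t: "0 \<le> t" by linarith
  have r: "0 \<le> r" "r * L \<le> \<eta>" using pq[OF x] by (auto simp: r_def L_def)
  have C: "1 \<le> slope_bound" by (simp add: slope_bound_def)
  have A: "1 \<le> exp (\<eta> * (1 + ln slope_bound))" using \<eta> C by simp
  have "(\<bar>f c - f d\<bar> / (d - c)) powr p x \<le> t powr p x"
    using ft cd p_ge[of x] by (intro powr_mono2) auto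
  also have "\<dots> \<le> exp (\<eta> * (1 + ln slope_bound)) * t powr q"
  \<comment> \<open>For \<open>t \<le> 1\<close> a smaller exponent gives a larger power; only steep
    slopes cost a factor.\<close>
  proof (cases "t \<le> 1")
    case True
    then have "t powr p x \<le> t powr q" using t pq(1)[OF x] q by (intro powr_mono') auto
    also have "\<dots> \<le> exp (\<eta> * (1 + ln slope_bound)) * t powr q"
      using mult_right_mono[OF A, of "t powr q"] by simp
    finally show ?thesis .
  next
    case False
    have "(LINT x:{c..<d}|M. \<bar>F x\<bar>) \<le> (LINT x|M. \<bar>F x\<bar>)"
      unfolding set_lebesgue_integral_def
      using F_int set_int[of "\<lambda>x. \<bar>F x\<bar>" c d] unfolding set_integrable_def
      by (intro integral_mono) (auto simp: indicator_def)
    then have "t \<le> slope_bound / (d - c)"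
      unfolding t_def slope_bound_def using cd by (intro divide_right_mono) auto
    then have "ln t \<le> ln (slope_bound / (d - c))" using False cd C by simp
    also have "\<dots> = ln slope_bound + ln (1 / (d - c))" using C cd by (simp add: ln_div)
    also have "ln (1 / (d - c)) \<le> L"
      unfolding L_def using cd by (subst ln_le_cancel_iff) (auto intro: add_pos_pos)
    \<comment> \<open>The summand \<open>exp 1\<close> in the logarithm makes
      \<open>L \<ge> 1\<close>, so the constant is absorbed into a multiple of
      \<open>L\<close>.\<close>
    also have "ln slope_bound \<le> ln slope_bound * L"
    proof -
      have "ln (exp 1) \<le> L" unfolding L_def using cd by (subst ln_le_cancel_iff) (auto intro: add_pos_pos)
      then show ?thesis using mult_left_mono[of 1 L "ln slope_bound"] C by simp
    qed
    finally have "ln t \<le> (1 + ln slope_bound) * L" by (simp add: algebra_simps)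
    then have "r * ln t \<le> (r * L) * (1 + ln slope_bound)"
      using mult_left_mono[of "ln t" "(1 + ln slope_bound) * L" r] r(1) by (simp add: algebra_simps)
    also have "\<dots> \<le> \<eta> * (1 + ln slope_bound)" using r(2) C by (intro mult_right_mono) auto
    finally have "t powr r \<le> exp (\<eta> * (1 + ln slope_bound))" using False by (simp add: powr_def)
    then have "t powr r * t powr q \<le> exp (\<eta> * (1 + ln slope_bound)) * t powr q"
      by (intro mult_right_mono) auto
    then show ?thesis by (simp add: r_def flip: powr_add)
  qed
  finally show ?thesis unfolding t_def .
qed

text \<open>\<open>q\<close> is the minimum of \<open>p\<close> on the cell, attained at some
  \<open>y\<close>. Since \<open>\<bar>x - y\<bar> \<le> d - c\<close>, the logarithm at
  \<open>d - c\<close> is the smaller one, and the condition for \<open>x\<close> and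
  \<open>y\<close> carries over.\<close>

lemma log_Hoelder_min:
  assumes cd: "a \<le> c" "c < d" "d \<le> b" and \<delta>: "d - c < \<delta>" and \<eta>: "0 \<le> \<eta>"
    and lh: "\<forall>y\<in>{a..b}. \<forall>x\<in>{a..b}. x \<noteq> y \<and> \<bar>x - y\<bar> < \<delta> \<longrightarrow>
      \<bar>p x - p y\<bar> * ln (exp 1 + 1 / \<bar>x - y\<bar>) < \<eta>"
  obtains q where "1 \<le> q" "\<And>x. x \<in> {c..d} \<Longrightarrow> q \<le> p x"
    "\<And>x. x \<in> {c..d} \<Longrightarrow> (p x - q) * ln (exp 1 + 1 / (d - c)) \<le> \<eta>"
proof -
  obtain y where y: "y \<in> {c..d}" "\<And>x. x \<in> {c..d} \<Longrightarrow> p y \<le> p x"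
    using continuous_attains_inf[of "{c..d}" p] cd continuous_on_subset[OF p_cont] by auto
  have "(p x - p y) * ln (exp 1 + 1 / (d - c)) \<le> \<eta>" if x: "x \<in> {c..d}" for x
  proof (cases "x = y")
    case False
    have xy: "0 < \<bar>x - y\<bar>" "\<bar>x - y\<bar> \<le> d - c" using x y(1) False by auto
    then have "1 / (d - c) \<le> 1 / \<bar>x - y\<bar>" using cd by (intro divide_left_mono) auto
    then have "ln (exp 1 + 1 / (d - c)) \<le> ln (exp 1 + 1 / \<bar>x - y\<bar>)"
      using cd xy by (subst ln_le_cancel_iff) (auto intro: add_pos_pos)
    then have "(p x - p y) * ln (exp 1 + 1 / (d - c)) \<le> \<bar>p x - p y\<bar> * ln (exp 1 + 1 / \<bar>x - y\<bar>)"
      using y(2)[OF x] by (auto intro: mult_left_mono)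
    also have "\<dots> < \<eta>" using lh x y(1) cd False xy \<delta> by auto
    finally show ?thesis by simp
  qed (use \<eta> in simp)
  then show ?thesis using that[of "p y"] y(2) p_ge by blast
qed

text \<open>For each \<open>\<eta>\<close> the Hoelder condition provides a mesh below which all
  Riesz sums are at most \<open>A \<eta> * (J + \<eta> * B)\<close>; this tends to \<open>J\<close>
  as \<open>\<eta>\<close> tends to 0.\<close>

theorem riesz_variation_le_integral:
  assumes G: "integrable M upper_density" and null: "AE x in M. x \<in> N \<longrightarrow> p x = 1"
    and lh: "strong_log_Hoelder {a..b} p"
  shows "riesz_variation \<phi> a b f \<le> ennreal (LINT x|M. upper_density x)"
proof -
  define B where "B = (LINT x|M. E x)"
  define J where "J = (LINT x|M. upper_density x)"
  define A where "A \<eta> = exp (\<eta> * (1 + ln slope_bound))" for \<eta>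
  have bound: "riesz_variation \<phi> a b f \<le> ennreal (A \<eta> * (J + \<eta> * B))" if \<eta>: "0 < \<eta>" for \<eta>
  proof -
    obtain \<delta> where \<delta>: "0 < \<delta>" "\<forall>y\<in>{a..b}. \<forall>x\<in>{a..b}. x \<noteq> y \<and> \<bar>x - y\<bar> < \<delta> \<longrightarrow>
      \<bar>p x - p y\<bar> * ln (exp 1 + 1 / \<bar>x - y\<bar>) < \<eta>"
      using lh \<eta> unfolding strong_log_Hoelder_def by metis
    show ?thesis
    proof (rule riesz_variation_le[OF \<delta>(1)])
      fix D assume D: "interval_partition a b D" and mesh: "mesh D < \<delta>"
      define u where "u x = upper_density x + \<eta> * E x" for x
      have u_int: "integrable M u" unfolding u_def using G E_int by auto
      have u_nonneg: "0 \<le> u x" for x using \<eta> by (simp add: u_def upper_density_def)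
      have "riesz_sum \<phi> f D \<le> (\<Sum>K\<in>D. ennreal (A \<eta> * (LINT x:{Inf K..<Sup K}|M. u x)))"
        unfolding riesz_sum_def
      proof (rule sum_mono)
        fix K assume K: "K \<in> D"
        define c where "c = Inf K"
        define d where "d = Sup K"
        have cd: "a \<le> c" "c < d" "d \<le> b" "measure lborel K = d - c" "K = {c..d}"
          using interval_partition_elem[OF D K] by (auto simp: c_def d_def)
        have dc: "d - c < \<delta>" using measure_le_mesh[OF D K] mesh cd(4) by auto
        obtain q where q: "1 \<le> q" "\<And>x. x \<in> {c..d} \<Longrightarrow> q \<le> p x"
          "\<And>x. x \<in> {c..d} \<Longrightarrow> (p x - q) * ln (exp 1 + 1 / (d - c)) \<le> \<eta>"
          using log_Hoelder_min[OF cd(1-3) dc less_imp_le[OF \<eta>] \<delta>(2)] by blast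
        \<comment> \<open>Dropping the logarithm leaves the plain oscillation bound that
          \<open>mean_slope_powr_le\<close> requires.\<close>
        have "1 \<le> ln (exp 1 + 1 / (d - c))"
          using ln_le_cancel_iff[of "exp 1" "exp 1 + 1 / (d - c)"] cd by (simp add: add_pos_pos)
        then have "p x - q \<le> (p x - q) * ln (exp 1 + 1 / (d - c))" if "x \<in> {c..d}" for x
          using mult_left_mono[of 1 "ln (exp 1 + 1 / (d - c))" "p x - q"] q(2)[OF that] by simp
        then have pq: "p x \<le> q + \<eta>" if "x \<in> {c..d}" for x
          using q(3)[OF that] that by force
        have "phi_plus \<phi> K (\<bar>f c - f d\<bar> / (d - c)) \<le> ennreal (A \<eta> * mean_slope c d powr q)"
          unfolding phi_plus_def A_def
          using phi_plus_term_le[OF cd(1-3) q(1) less_imp_le[OF \<eta>] q(2,3)] cd(5)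
          by (intro SUP_least ennreal_leI) auto
        then have "phi_plus \<phi> K (\<bar>f c - f d\<bar> / (d - c)) * ennreal (d - c)
            \<le> ennreal (A \<eta> * mean_slope c d powr q) * ennreal (d - c)"
          by (rule mult_right_mono) simp
        also have "\<dots> = ennreal (A \<eta> * (mean_slope c d powr q * (d - c)))"
          using cd by (simp add: A_def mult.assoc flip: ennreal_mult)
        also have "\<dots> \<le> ennreal (A \<eta> * (LINT x:{c..<d}|M. u x))"
          unfolding u_def using mean_slope_powr_le[OF G null cd(1-3) q(1,2) pq]
          by (intro ennreal_leI mult_left_mono) (auto simp: A_def)
        finally show "phi_plus \<phi> K (\<bar>f (Inf K) - f (Sup K)\<bar> / measure lborel K) * ennreal (measure lborel K)
            \<le> ennreal (A \<eta> * (LINT x:{Inf K..<Sup K}|M. u x))"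
          using cd(4) by (simp add: c_def d_def)
      qed
      also have "\<dots> = ennreal (A \<eta> * (\<Sum>K\<in>D. LINT x:{Inf K..<Sup K}|M. u x))"
        unfolding sum_distrib_left
        by (intro sum_ennreal mult_nonneg_nonneg)
          (auto simp: A_def set_lebesgue_integral_def u_nonneg intro!: integral_nonneg_AE)
      also have "(\<Sum>K\<in>D. LINT x:{Inf K..<Sup K}|M. u x) = (LINT x|M. u x)"
        by (rule interval_partition_sum_integral[OF D sets_M conc_M u_int])
      also have "\<dots> = J + \<eta> * B"
        unfolding u_def J_def B_def using G E_int by simp
      finally show "riesz_sum \<phi> f D \<le> ennreal (A \<eta> * (J + \<eta> * B))" .
    qed
  qed
  have "(\<lambda>n. A (1 / real (Suc n)) * (J + 1 / real (Suc n) * B)) \<longlonglongrightarrow> exp (0 * (1 + ln slope_bound)) * (J + 0 * B)"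
    unfolding A_def by (intro tendsto_intros LIMSEQ_Suc[OF lim_1_over_n])
  then have "(\<lambda>n. ennreal (A (1 / real (Suc n)) * (J + 1 / real (Suc n) * B))) \<longlonglongrightarrow> ennreal J"
    by (intro tendsto_ennrealI) simp
  moreover have "riesz_variation \<phi> a b f \<le> ennreal (A (1 / real (Suc n)) * (J + 1 / real (Suc n) * B))" for n
    by (rule bound) simp
  ultimately show ?thesis
    unfolding J_def[symmetric] by (intro LIMSEQ_le_const) blast+
qed

text \<open>Mass of \<open>N\<close> where \<open>p > 1\<close> enters the lower bound with factor
  \<open>\<infinity>\<close>. Without such mass the densities of both bounds agree almost
  everywhere. The upper bound requires integrability, so an infinite \<open>W\<close> is settled by
  the lower bound.\<close>

theorem riesz_variation_representation:
  assumes lh: "strong_log_Hoelder {a..b} p"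
  shows "(riesz_variation \<phi> a b f < \<infinity> \<longrightarrow> emeasure M {x\<in>N. p x > 1} = 0) \<and>
    (emeasure M {x\<in>N. p x > 1} = 0 \<longrightarrow> riesz_variation \<phi> a b f =
      (\<integral>\<^sup>+x. ennreal (E x) * ennreal (\<bar>F x\<bar> powr p x) \<partial>M) + emeasure M {x\<in>N. p x = 1})"
proof -
  define V where "V = riesz_variation \<phi> a b f"
  define S where "S = {x\<in>N. p x > 1}"
  define T where "T = {x\<in>N. p x = 1}"
  define W where "W = (\<integral>\<^sup>+x. ennreal (E x) * ennreal (\<bar>F x\<bar> powr p x) \<partial>M)"
  have "{x. 1 < p x} \<in> sets borel" "{x. p x = 1} \<in> sets borel"
    using p_meas by measurable
  then have "N \<inter> {x. 1 < p x} \<in> sets borel" "N \<inter> {x. p x = 1} \<in> sets borel"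
    using N_sets by auto
  then have ST: "S \<in> sets M" "T \<in> sets M"
    unfolding S_def T_def sets_M by (simp_all add: Collect_conj_eq)
  have "(\<lambda>x. ennreal (E x) * ennreal (\<bar>F x\<bar> powr p x)) \<in> borel_measurable borel"
    using N_sets F_meas p_meas by measurable
  then have W_meas: "(\<lambda>x. ennreal (E x) * ennreal (\<bar>F x\<bar> powr p x)) \<in> borel_measurable M"
    by (rule meas_M)
  have lower: "lower_density x = ennreal (E x) * ennreal (\<bar>F x\<bar> powr p x) + (indicator T x + \<infinity> * indicator S x)" for x
    using p_ge[of x] by (auto simp: lower_density_def S_def T_def indicator_def)
  have "(\<integral>\<^sup>+x. lower_density x \<partial>M) = W + (emeasure M T + \<infinity> * emeasure M S)"
    unfolding lower W_def using W_meas ST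
    by (subst nn_integral_add, simp, simp)
      (subst nn_integral_add, simp_all add: nn_integral_cmult_indicator)
  then have ge: "W + (emeasure M T + \<infinity> * emeasure M S) \<le> V"
    using nn_integral_lower_density_le unfolding V_def by simp
  have "emeasure M S = 0" if "V < \<infinity>"
  proof (rule ccontr)
    assume "emeasure M S \<noteq> 0"
    then have S: "\<infinity> * emeasure M S = \<infinity>" by (simp add: ennreal_top_mult)
    have "\<infinity> \<le> V" using ge unfolding S by simp
    then show False using that by (simp add: top_unique)
  qed
  moreover have "V = W + emeasure M T" if S0: "emeasure M S = 0"
  proof (cases "W = \<infinity>")
    case True
    then show ?thesis using ge by (simp add: top_unique)
  next
    case False
    have "S \<in> null_sets M" using S0 ST(1) by auto
    then have "AE x in M. x \<notin> S" by (rule AE_not_in)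
    then have null: "AE x in M. x \<in> N \<longrightarrow> p x = 1"
    proof eventually_elim
      case (elim x)
      then show ?case using p_ge[of x] by (auto simp: S_def)
    qed
    have "AE x in M. ennreal (upper_density x) = ennreal (E x) * ennreal (\<bar>F x\<bar> powr p x) + indicator T x"
      using null by eventually_elim (auto simp: upper_density_def T_def)
    then have "(\<integral>\<^sup>+x. ennreal (upper_density x) \<partial>M) =
        (\<integral>\<^sup>+x. ennreal (E x) * ennreal (\<bar>F x\<bar> powr p x) + indicator T x \<partial>M)"
      by (rule nn_integral_cong_AE)
    also have "\<dots> = W + emeasure M T"
      unfolding W_def using W_meas ST by (subst nn_integral_add) auto
    finally have upper: "(\<integral>\<^sup>+x. ennreal (upper_density x) \<partial>M) = W + emeasure M T" .
    have "W + emeasure M T < \<infinity>" using False by (simp add: less_top emeasure_eq_measure)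
    moreover have "upper_density \<in> borel_measurable borel"
      unfolding upper_density_def using N_sets F_meas p_meas by measurable
    ultimately have G: "integrable M upper_density"
      using upper by (intro integrableI_nonneg meas_M AE_I2) (simp_all add: upper_density_def)
    have "V \<le> ennreal (LINT x|M. upper_density x)"
      unfolding V_def by (rule riesz_variation_le_integral[OF G null lh])
    also have "\<dots> = W + emeasure M T"
      unfolding upper[symmetric]
      by (rule nn_integral_eq_integral[OF G, symmetric]) (simp add: upper_density_def)
    finally have "V \<le> W + emeasure M T" .
    then show ?thesis using ge S0 by (intro antisym) simp_all
  qed
  ultimately show ?thesis unfolding V_def S_def T_def W_def by blast
qed
end

section \<open>The density of the derivative measure\<close>

text \<open>For a positive set \<open>P\<close> of a Hahn decomposition this is the total variation,
  kept real-valued so that it is again a signed measure.\<close>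

definition variation_of :: "('a set \<Rightarrow> real) \<Rightarrow> 'a set \<Rightarrow> 'a set \<Rightarrow> real" where
  "variation_of \<nu> P A = \<nu> (A \<inter> P) - \<nu> (A - P)"

lemma variation_of_signed_measure:
  assumes sm: "signed_measure M \<nu>" and P: "P \<in> sets M"
  shows "signed_measure M (variation_of \<nu> P)"
  unfolding signed_measure_def
proof (intro conjI allI impI)
  show "variation_of \<nu> P {} = 0" by (simp add: variation_of_def)
  fix A :: "nat \<Rightarrow> 'a set" assume A: "range A \<subseteq> sets M" "disjoint_family A"
  have "disjoint_family (\<lambda>n. A n \<inter> P)" "disjoint_family (\<lambda>n. A n - P)"
    by (rule disjoint_family_on_bisimulation[OF A(2)]; blast)+
  moreover have "range (\<lambda>n. A n \<inter> P) \<subseteq> sets M" "range (\<lambda>n. A n - P) \<subseteq> sets M"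
    using A(1) P by auto
  ultimately have "(\<lambda>n. \<nu> (A n \<inter> P)) sums \<nu> (\<Union>n. A n \<inter> P)" "(\<lambda>n. \<nu> (A n - P)) sums \<nu> (\<Union>n. A n - P)"
    using signed_measure_sums[OF sm, of "\<lambda>n. A n \<inter> P"] signed_measure_sums[OF sm, of "\<lambda>n. A n - P"] by blast+
  moreover have "(\<Union>n. A n \<inter> P) = (\<Union>n. A n) \<inter> P" "(\<Union>n. A n - P) = (\<Union>n. A n) - P" by auto
  ultimately show "(\<lambda>n. variation_of \<nu> P (A n)) sums variation_of \<nu> P (\<Union>n. A n)"
    unfolding variation_of_def using sums_diff by fastforce
qed

lemma signed_measure_finite_Union:
  assumes sm: "signed_measure M \<nu>" and "finite \<A>" "\<A> \<subseteq> sets M" "disjoint \<A>"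
  shows "\<nu> (\<Union>\<A>) = (\<Sum>A\<in>\<A>. \<nu> A)"
  using assms(2-4)
proof (induction \<A> rule: finite_induct)
  case empty
  then show ?case using signed_measure_empty[OF sm] by simp
next
  case (insert A \<A>)
  have "A \<inter> \<Union>\<A> = {}" using insert by (auto simp: pairwise_def disjnt_def)
  then have "\<nu> (A \<union> \<Union>\<A>) = \<nu> A + \<nu> (\<Union>\<A>)"
    using insert by (intro signed_measure_Un[OF sm]) (auto intro!: sets.finite_Union)
  then show ?case using insert by (simp add: pairwise_insert)
qed

text \<open>Additivity of \<open>variation_of\<close>, which dominates
  \<open>\<bar>\<nu> C\<bar>\<close> on each piece, bounds every partition sum; the pieces
  \<open>A \<inter> P\<close> and \<open>A - P\<close> attain the bound.\<close>

lemma total_variation_eq: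
  assumes sm: "signed_measure M \<nu>" and P: "P \<in> sets M"
    and pos: "\<And>C. C \<in> sets M \<Longrightarrow> C \<subseteq> P \<Longrightarrow> 0 \<le> \<nu> C"
    and neg: "\<And>C. C \<in> sets M \<Longrightarrow> C \<inter> P = {} \<Longrightarrow> \<nu> C \<le> 0"
    and A: "A \<in> sets M"
  shows "total_variation M \<nu> A = ennreal (variation_of \<nu> P A)"
proof (rule antisym)
  have abs_le: "\<bar>\<nu> C\<bar> \<le> variation_of \<nu> P C" if "C \<in> sets M" for C
  proof -
    have "0 \<le> \<nu> (C \<inter> P)" "\<nu> (C - P) \<le> 0" using that P by (auto intro!: pos neg)
    then show ?thesis using signed_measure_split[OF sm that P] by (simp add: variation_of_def)
  qed
  show "total_variation M \<nu> A \<le> ennreal (variation_of \<nu> P A)"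
    unfolding total_variation_def
  proof (rule SUP_least)
    fix \<A> assume "\<A> \<in> {\<A>. finite \<A> \<and> \<A> \<subseteq> sets M \<and> disjoint \<A> \<and> \<Union>\<A> = A}"
    then have \<A>: "finite \<A>" "\<A> \<subseteq> sets M" "disjoint \<A>" "\<Union>\<A> = A" by auto
    have "(\<Sum>C\<in>\<A>. ennreal \<bar>\<nu> C\<bar>) = ennreal (\<Sum>C\<in>\<A>. \<bar>\<nu> C\<bar>)" by (simp add: sum_ennreal)
    also have "\<dots> \<le> ennreal (\<Sum>C\<in>\<A>. variation_of \<nu> P C)"
      using \<A>(2) abs_le by (intro ennreal_leI sum_mono) auto
    also have "(\<Sum>C\<in>\<A>. variation_of \<nu> P C) = variation_of \<nu> P A"
      using signed_measure_finite_Union[OF variation_of_signed_measure[OF sm P] \<A>(1-3)] \<A>(4) by simp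
    finally show "(\<Sum>C\<in>\<A>. ennreal \<bar>\<nu> C\<bar>) \<le> ennreal (variation_of \<nu> P A)" .
  qed
  have "ennreal (variation_of \<nu> P A) = (\<Sum>C\<in>{A \<inter> P, A - P}. ennreal \<bar>\<nu> C\<bar>)"
  \<comment> \<open>The pieces coincide only for empty \<open>A\<close>, where the sum over the set
    would have a single term.\<close>
  proof (cases "A \<inter> P = A - P")
    case True
    then have "A = {}" by auto
    then show ?thesis using signed_measure_empty[OF sm] by (simp add: variation_of_def)
  next
    case False
    have "0 \<le> \<nu> (A \<inter> P)" "\<nu> (A - P) \<le> 0" using A P by (auto intro!: pos neg)
    then show ?thesis using False by (simp add: variation_of_def sum_ennreal)
  qed
  also have "\<dots> \<le> total_variation M \<nu> A"
    unfolding total_variation_def using A P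
    by (intro SUP_upper) (auto simp: pairwise_def disjnt_def)
  finally show "ennreal (variation_of \<nu> P A) \<le> total_variation M \<nu> A" .
qed

lemma nonneg_signed_measure_measure:
  assumes sm: "signed_measure R \<nu>" and nonneg: "\<And>A. A \<in> sets R \<Longrightarrow> 0 \<le> \<nu> A"
  obtains M where "sets M = sets R" "finite_measure M" "\<And>A. A \<in> sets R \<Longrightarrow> measure M A = \<nu> A"
proof -
  define M where "M = measure_of (space R) (sets R) (\<lambda>A. ennreal (\<nu> A))"
  have sets: "sets M = sets R" unfolding M_def by simp
  have em: "emeasure M A = ennreal (\<nu> A)" if "A \<in> sets R" for A
    unfolding M_def
  proof (rule emeasure_measure_of_sigma)
    show "sigma_algebra (space R) (sets R)" by (rule sets.sigma_algebra_axioms)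
    show "positive (sets R) (\<lambda>A. ennreal (\<nu> A))"
      using signed_measure_empty[OF sm] by (simp add: positive_def)
    show "countably_additive (sets R) (\<lambda>A. ennreal (\<nu> A))"
      unfolding countably_additive_def
      using nonneg signed_measure_sums[OF sm] by (intro allI impI suminf_ennreal_eq) auto
  qed (rule that)
  have "space M = space R" using sets by (rule sets_eq_imp_space_eq)
  then have "finite_measure M" using em[of "space R"] by (intro finite_measureI) simp
  moreover have "measure M A = \<nu> A" if "A \<in> sets R" for A
    using em[OF that] nonneg[OF that] by (simp add: measure_def)
  ultimately show ?thesis using that sets by blast
qed

section \<open>Restriction and continuity of the exponent\<close>

lemma riesz_variation_cong:
  assumes "\<And>x t. x \<in> {a..b} \<Longrightarrow> \<phi> x t = \<psi> x t"
  shows "riesz_variation \<phi> a b f = riesz_variation \<psi> a b f"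
proof -
  have "riesz_sum \<phi> f D = riesz_sum \<psi> f D" if D: "interval_partition a b D" for D
    unfolding riesz_sum_def phi_plus_def
  proof (intro sum.cong refl arg_cong2[where f="(*)"] SUP_cong)
    fix K x assume "K \<in> D" "x \<in> K"
    then have "x \<in> {a..b}" using D unfolding interval_partition_def by blast
    then show "\<phi> x t = \<psi> x t" for t by (rule assms)
  qed
  then show ?thesis
    unfolding riesz_variation_eq_INF by (intro INF_cong SUP_cong refl) auto
qed

lemma strong_log_Hoelder_mono:
  assumes "strong_log_Hoelder \<Omega> p" "S \<subseteq> \<Omega>"
  shows "strong_log_Hoelder S p"
  unfolding strong_log_Hoelder_def
proof (intro allI impI)
  fix \<epsilon> :: real assume "0 < \<epsilon>"
  then obtain \<delta> where "0 < \<delta>" "\<forall>y\<in>\<Omega>. \<forall>x\<in>\<Omega>. x \<noteq> y \<and> \<bar>x - y\<bar> < \<delta> \<longrightarrow>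
      \<bar>p x - p y\<bar> * ln (exp 1 + 1 / \<bar>x - y\<bar>) < \<epsilon>"
    using assms(1) unfolding strong_log_Hoelder_def by metis
  then show "\<exists>\<delta>>0. \<forall>y\<in>S. \<forall>x\<in>S. x \<noteq> y \<and> \<bar>x - y\<bar> < \<delta> \<longrightarrow>
      \<bar>p x - p y\<bar> * ln (exp 1 + 1 / \<bar>x - y\<bar>) < \<epsilon>"
    using assms(2) by blast
qed

lemma strong_log_Hoelder_cong:
  assumes "\<And>x. x \<in> S \<Longrightarrow> p x = q x"
  shows "strong_log_Hoelder S p \<longleftrightarrow> strong_log_Hoelder S q"
  unfolding strong_log_Hoelder_def by (simp add: assms cong: ball_cong)

lemma strong_log_Hoelder_continuous_on:
  assumes "strong_log_Hoelder S p"
  shows "continuous_on S p"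
  unfolding continuous_on_iff
proof (intro ballI allI impI)
  fix y \<epsilon> :: real assume y: "y \<in> S" and \<epsilon>: "0 < \<epsilon>"
  obtain \<delta> where \<delta>: "0 < \<delta>" "\<forall>y\<in>S. \<forall>x\<in>S. x \<noteq> y \<and> \<bar>x - y\<bar> < \<delta> \<longrightarrow>
      \<bar>p x - p y\<bar> * ln (exp 1 + 1 / \<bar>x - y\<bar>) < \<epsilon>"
    using assms \<epsilon> unfolding strong_log_Hoelder_def by metis
  have "dist (p x) (p y) < \<epsilon>" if x: "x \<in> S" "dist x y < \<delta>" for x
  proof (cases "x = y")
    case False
    have "1 \<le> ln (exp 1 + 1 / \<bar>x - y\<bar>)"
      using ln_le_cancel_iff[of "exp 1" "exp 1 + 1 / \<bar>x - y\<bar>"] by (simp add: add_pos_nonneg)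
    then have "\<bar>p x - p y\<bar> \<le> \<bar>p x - p y\<bar> * ln (exp 1 + 1 / \<bar>x - y\<bar>)"
      using mult_left_mono[of 1 "ln (exp 1 + 1 / \<bar>x - y\<bar>)" "\<bar>p x - p y\<bar>"] by simp
    also have "\<dots> < \<epsilon>" using \<delta>(2) x y False by (simp add: dist_real_def)
    finally show ?thesis by (simp add: dist_real_def)
  qed (use \<epsilon> in simp)
  then show "\<exists>d>0. \<forall>x\<in>S. dist x y < d \<longrightarrow> dist (p x) (p y) < \<epsilon>" using \<delta>(1) by blast
qed

section \<open>The control measure and the density of \<open>Df\<close>\<close>

lemma sets_borel_on: "A \<in> sets (borel_on a b) \<longleftrightarrow> A \<in> sets borel \<and> A \<subseteq> {a..b}"
  by (auto simp: sets_restrict_space_iff)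

text \<open>The measure is built on the Borel sets of the whole line, with mass only in
  \<open>{a..b}\<close>, because the approximation lemmas ask for
  \<open>sets M = sets borel\<close>.\<close>

lemma exists_control_measure:
  assumes sm: "signed_measure (borel_on a b) \<mu>" and nonneg: "\<And>A. A \<in> sets (borel_on a b) \<Longrightarrow> 0 \<le> \<mu> A"
  obtains M :: "real measure" where "sets M = sets borel" "finite_measure M"
    "\<And>A. A \<in> sets borel \<Longrightarrow> measure M A = measure lborel (A \<inter> {a..b}) + \<mu> (A \<inter> {a..b})"
proof (rule nonneg_signed_measure_measure[of "borel :: real measure"])
  let ?\<rho> = "\<lambda>A. measure lborel (A \<inter> {a..b}) + \<mu> (A \<inter> {a..b})"
  show "0 \<le> ?\<rho> A" if "A \<in> sets borel" for A
    using nonneg[of "A \<inter> {a..b}"] that by (simp add: sets_borel_on)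
  show "signed_measure (borel :: real measure) ?\<rho>"
    unfolding signed_measure_def
  proof (intro conjI allI impI)
    show "?\<rho> {} = 0" using signed_measure_empty[OF sm] by simp
    fix A :: "nat \<Rightarrow> real set" assume A: "range A \<subseteq> sets borel" "disjoint_family A"
    have disj: "disjoint_family (\<lambda>n. A n \<inter> {a..b})"
      by (rule disjoint_family_on_bisimulation[OF A(2)]) blast
    have UN: "(\<Union>n. A n \<inter> {a..b}) = (\<Union>n. A n) \<inter> {a..b}" by auto
    have "range (\<lambda>n. A n \<inter> {a..b}) \<subseteq> sets (borel_on a b)"
      using A(1) by (auto simp: sets_borel_on)
    then have 1: "(\<lambda>n. \<mu> (A n \<inter> {a..b})) sums \<mu> ((\<Union>n. A n) \<inter> {a..b})"
      using signed_measure_sums[OF sm _ disj] UN by simp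
    have "emeasure lborel ((\<Union>n. A n) \<inter> {a..b}) \<le> emeasure lborel {a..b}"
      by (intro emeasure_mono) auto
    also have "\<dots> < \<infinity>" by (simp add: emeasure_lborel_Icc_eq)
    finally have "emeasure lborel (\<Union>n. A n \<inter> {a..b}) \<noteq> \<infinity>" unfolding UN by simp
    moreover have "range (\<lambda>n. A n \<inter> {a..b}) \<subseteq> sets lborel" using A(1) by auto
    ultimately have "(\<lambda>n. measure lborel (A n \<inter> {a..b})) sums measure lborel (\<Union>n. A n \<inter> {a..b})"
      using disj by (intro measure_UNION)
    then show "(\<lambda>n. ?\<rho> (A n)) sums ?\<rho> (\<Union>n. A n)" using 1 unfolding UN by (rule sums_add)
  qed
qed (rule that)

text \<open>Off \<open>N\<close> the summand \<open>\<mu>\<close> vanishes. Equality of the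
  restricted measures, rather than of values on sets, transfers integrals between \<open>M\<close>
  and Lebesgue measure.\<close>

lemma control_measure_density:
  fixes M :: "real measure"
  assumes sets: "sets M = sets borel" and fin: "finite_measure M"
    and meas: "\<And>A. A \<in> sets borel \<Longrightarrow> measure M A = measure lborel (A \<inter> {a..b}) + \<mu> (A \<inter> {a..b})"
    and N: "N \<in> sets borel" and zero: "\<And>A. A \<in> sets (borel_on a b) \<Longrightarrow> A \<inter> N = {} \<Longrightarrow> \<mu> A = 0"
  shows "density M (indicator (- N)) = density lborel (indicator ({a..b} - N))"
proof (rule measure_eqI)
  show "sets (density M (indicator (- N))) = sets (density lborel (indicator ({a..b} - N)))"
    by (simp add: sets)
  fix A assume "A \<in> sets (density M (indicator (- N)))"
  then have A: "A \<in> sets borel" by (simp add: sets)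
  have "emeasure (density M (indicator (- N))) A = emeasure M (- N \<inter> A)"
    using A N by (intro emeasure_restricted) (simp_all add: sets)
  also have "\<dots> = ennreal (measure M (- N \<inter> A))"
    using fin by (simp add: finite_measure.emeasure_eq_measure)
  also have "measure M (- N \<inter> A) = measure lborel (- N \<inter> A \<inter> {a..b})"
    using A N zero[of "- N \<inter> A \<inter> {a..b}"] by (subst meas) (auto simp: sets_borel_on)
  also have "ennreal \<dots> = emeasure lborel (- N \<inter> A \<inter> {a..b})"
  proof (rule emeasure_eq_ennreal_measure[symmetric])
    have "emeasure lborel (- N \<inter> A \<inter> {a..b}) \<le> emeasure lborel {a..b}"
      by (intro emeasure_mono) auto
    then show "emeasure lborel (- N \<inter> A \<inter> {a..b}) \<noteq> top"
      using neq_top_trans[of "emeasure lborel {a..b}"] by (simp add: emeasure_lborel_Icc_eq)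
  qed
  also have "- N \<inter> A \<inter> {a..b} = ({a..b} - N) \<inter> A" by auto
  also have "emeasure lborel (({a..b} - N) \<inter> A) = emeasure (density lborel (indicator ({a..b} - N))) A"
    using A N by (intro emeasure_restricted[symmetric]) simp_all
  finally show "emeasure (density M (indicator (- N))) A = emeasure (density lborel (indicator ({a..b} - N))) A" .
qed

text \<open>The control measure is Lebesgue measure plus the total variation of the singular part;
  \<open>F\<close> is the density of \<open>Df\<close> with respect to it, which equals \<open>f'\<close> off the singular set \<open>N\<close>
  and the sign of the Hahn decomposition on \<open>N\<close>.\<close>
lemma exists_derivative_density:
  assumes ab: "a < b" and p: "continuous_on UNIV p" "\<And>x. 1 \<le> p x" "\<And>x. p x \<le> P"
    and Df: "derivative_measure a b f Df" and dec: "lebesgue_decomposition a b Df f' Dsf"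
  obtains M N F where "derivative_density a b P f p F M N"
    "(\<integral>\<^sup>+x\<in>{a..b}. ennreal (\<bar>f' x\<bar> powr p x) \<partial>lebesgue) =
       (\<integral>\<^sup>+x. ennreal (indicator (- N) x) * ennreal (\<bar>F x\<bar> powr p x) \<partial>M)"
    "N \<subseteq> {a..b}"
    "\<And>A. A \<in> sets borel \<Longrightarrow> A \<subseteq> {a..b} \<Longrightarrow>
       total_variation (borel_on a b) Dsf A = emeasure M (A \<inter> N)"
proof -
  let ?R = "borel_on a b"
  have sm: "signed_measure ?R Dsf" and f'_int: "set_integrable lebesgue {a..b} f'"
    and sing: "lebesgue_singular a b Dsf"
    and Df_eq: "\<And>A. A \<in> sets ?R \<Longrightarrow> Df A = (LINT x:A|lebesgue. f' x) + Dsf A"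
    using dec unfolding lebesgue_decomposition_def by auto
  have sm_Df: "signed_measure ?R Df" and f_Df: "\<And>x. x \<in> {a..b} \<Longrightarrow> f x = f a + Df {a..<x}" and Df_b: "Df {b} = 0"
    using Df unfolding derivative_measure_def by blast+
  obtain N where N: "N \<in> sets ?R" "emeasure lborel N = 0" "\<And>A. A \<in> sets ?R \<Longrightarrow> A \<inter> N = {} \<Longrightarrow> Dsf A = 0"
    using sing unfolding lebesgue_singular_def by blast
  have N': "N \<in> sets borel" "N \<subseteq> {a..b}" using N(1) by (auto simp: sets_borel_on)
  obtain Q where Q: "Q \<in> sets ?R" "\<And>C. C \<in> sets ?R \<Longrightarrow> C \<subseteq> Q \<Longrightarrow> 0 \<le> Dsf C"
    "\<And>C. C \<in> sets ?R \<Longrightarrow> C \<inter> Q = {} \<Longrightarrow> Dsf C \<le> 0"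
    using signed_measure_Hahn_decomposition[OF sm] by blast
  have Q': "Q \<in> sets borel" using Q(1) by (auto simp: sets_borel_on)
  define \<mu> where "\<mu> = variation_of Dsf Q"
  have sm_\<mu>: "signed_measure ?R \<mu>" unfolding \<mu>_def by (rule variation_of_signed_measure[OF sm Q(1)])
  have \<mu>_nonneg: "0 \<le> \<mu> A" if A: "A \<in> sets ?R" for A
  proof -
    have "0 \<le> Dsf (A \<inter> Q)" "Dsf (A - Q) \<le> 0" using A Q(1) by (auto intro!: Q(2,3))
    then show ?thesis by (simp add: \<mu>_def variation_of_def)
  qed
  have \<mu>_zero: "\<mu> A = 0" if A: "A \<in> sets ?R" "A \<inter> N = {}" for A
  proof -
    have "Dsf (A \<inter> Q) = 0" "Dsf (A - Q) = 0" using A Q(1) by (auto intro!: N(3))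
    then show ?thesis by (simp add: \<mu>_def variation_of_def)
  qed
  have tv: "total_variation ?R Dsf A = ennreal (\<mu> A)" if "A \<in> sets ?R" for A
    unfolding \<mu>_def by (rule total_variation_eq[OF sm Q(1) _ _ that]) (use Q in auto)
  obtain M :: "real measure" where M: "sets M = sets borel" "finite_measure M"
    "\<And>A. A \<in> sets borel \<Longrightarrow> measure M A = measure lborel (A \<inter> {a..b}) + \<mu> (A \<inter> {a..b})"
    using exists_control_measure[OF sm_\<mu> \<mu>_nonneg] by blast
  interpret finite_measure M by fact
  have dens: "density M (indicator (- N)) = density lborel (indicator ({a..b} - N))"
    by (rule control_measure_density[OF M N'(1) \<mu>_zero])
  have M_N: "measure M (A \<inter> N) = \<mu> (A \<inter> N)" if "A \<in> sets borel" for A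
  proof -
    have "emeasure lborel (A \<inter> N) \<le> emeasure lborel N" using N' by (intro emeasure_mono) auto
    then have "measure lborel (A \<inter> N) = 0" using N(2) by (simp add: measure_def)
    moreover have "A \<inter> N \<inter> {a..b} = A \<inter> N" using N'(2) by auto
    ultimately show ?thesis using M(3)[of "A \<inter> N"] that N'(1) by simp
  qed
  \<comment> \<open>\<open>f'\<close> is only Lebesgue measurable, whereas \<open>F\<close> has to
    be Borel; \<open>g\<close> is a Borel version of \<open>f'\<close> cut off to
    \<open>{a..b}\<close>.\<close>
  obtain g where g: "g \<in> borel_measurable lborel" "AE x in lborel. indicator {a..b} x * f' x = g x"
    using completion_ex_borel_measurable_real[of "\<lambda>x. indicator {a..b} x * f' x" lborel] f'_int
    unfolding set_integrable_def by auto
  define F where "F x = (if x \<in> N then (if x \<in> Q then 1 else - 1) else g x)" for x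
  have F_meas: "F \<in> borel_measurable borel"
    unfolding F_def using N'(1) Q' g(1) by measurable
  have N_AE: "AE x in lborel. x \<notin> N" using N(2) N'(1) by (intro AE_not_in) auto
  have F_AE: "AE x in lborel. indicator {a..b} x * f' x = F x"
    using g(2) N_AE by eventually_elim (simp add: F_def)
  have E_meas: "(indicator (- N) :: real \<Rightarrow> real) \<in> borel_measurable borel"
    using N'(1) by measurable
  have dens': "density M (\<lambda>x. ennreal (indicator (- N) x)) = density lborel (\<lambda>x. ennreal (indicator ({a..b} - N) x))"
    using dens by (simp add: ennreal_indicator)
  have off_N: "integrable M (\<lambda>x. indicator (- N) x *\<^sub>R h x) \<longleftrightarrow> integrable lborel (\<lambda>x. indicator ({a..b} - N) x *\<^sub>R h x)"
    "(LINT x|M. indicator (- N) x *\<^sub>R h x) = (LINT x|lborel. indicator ({a..b} - N) x *\<^sub>R h x)"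
    if h: "h \<in> borel_measurable borel" for h :: "real \<Rightarrow> real"
  proof -
    have hM: "h \<in> borel_measurable M" "(indicator (- N) :: real \<Rightarrow> real) \<in> borel_measurable M"
      using h E_meas by (simp_all add: measurable_cong_sets[OF M(1) refl])
    have hL: "h \<in> borel_measurable lborel" "(indicator ({a..b} - N) :: real \<Rightarrow> real) \<in> borel_measurable lborel"
      using h N'(1) by simp_all
    show "integrable M (\<lambda>x. indicator (- N) x *\<^sub>R h x) \<longleftrightarrow> integrable lborel (\<lambda>x. indicator ({a..b} - N) x *\<^sub>R h x)"
      using integrable_density[OF hM AE_I2] integrable_density[OF hL AE_I2] dens' by simp
    show "(LINT x|M. indicator (- N) x *\<^sub>R h x) = (LINT x|lborel. indicator ({a..b} - N) x *\<^sub>R h x)"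
      using integral_density[OF hM AE_I2] integral_density[OF hL AE_I2] dens' by simp
  qed
  have AE_eq: "AE x in lebesgue. indicator A x *\<^sub>R f' x = indicator ({a..b} - N) x *\<^sub>R (indicator A x *\<^sub>R F x)"
    if "A \<subseteq> {a..b}" for A
  proof -
    have "AE x in lebesgue. indicator {a..b} x * f' x = F x \<and> x \<notin> N"
      using F_AE N_AE by (intro AE_completion) auto
    then show ?thesis
    proof eventually_elim
      case (elim x)
      then show ?case using that by (cases "x \<in> A") (auto simp: subset_iff)
    qed
  qed
  have AF_meas: "(\<lambda>x. indicator A x *\<^sub>R F x) \<in> borel_measurable borel" if "A \<in> sets borel" for A :: "real set"
    using that F_meas by measurable
  have AF_meas': "(\<lambda>x. indicator ({a..b} - N) x *\<^sub>R (indicator A x *\<^sub>R F x)) \<in> borel_measurable lborel"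
    if "A \<in> sets borel" for A :: "real set"
    using AF_meas[OF that] N'(1) by measurable
  have f'_A: "set_integrable lebesgue A f'" if "A \<in> sets borel" "A \<subseteq> {a..b}" for A
    using set_integrable_subset[OF f'_int] that by simp
  have int_off: "integrable M (\<lambda>x. indicator (- N) x *\<^sub>R (indicator A x *\<^sub>R F x))"
    and eq_off: "(LINT x|M. indicator (- N) x *\<^sub>R (indicator A x *\<^sub>R F x)) = (LINT x:A|lebesgue. f' x)"
    if A: "A \<in> sets borel" "A \<subseteq> {a..b}" for A
  proof -
    have m1: "(\<lambda>x. indicator A x *\<^sub>R f' x) \<in> borel_measurable lebesgue"
      using f'_A[OF A] unfolding set_integrable_def by (rule borel_measurable_integrable)
    have m2: "(\<lambda>x. indicator ({a..b} - N) x *\<^sub>R (indicator A x *\<^sub>R F x)) \<in> borel_measurable lebesgue"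
      using AF_meas'[OF A(1)] by (rule measurable_completion)
    have "integrable lebesgue (\<lambda>x. indicator ({a..b} - N) x *\<^sub>R (indicator A x *\<^sub>R F x))"
      using f'_A[OF A] integrable_cong_AE[OF m1 m2 AE_eq[OF A(2)]] unfolding set_integrable_def by simp
    then show "integrable M (\<lambda>x. indicator (- N) x *\<^sub>R (indicator A x *\<^sub>R F x))"
      unfolding off_N(1)[OF AF_meas[OF A(1)]] integrable_completion[OF AF_meas'[OF A(1)]] .
    have "(LINT x:A|lebesgue. f' x) = (LINT x|lebesgue. indicator ({a..b} - N) x *\<^sub>R (indicator A x *\<^sub>R F x))"
      unfolding set_lebesgue_integral_def by (rule integral_cong_AE[OF m1 m2 AE_eq[OF A(2)]])
    then show "(LINT x|M. indicator (- N) x *\<^sub>R (indicator A x *\<^sub>R F x)) = (LINT x:A|lebesgue. f' x)"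
      unfolding off_N(2)[OF AF_meas[OF A(1)]] integral_completion[OF AF_meas'[OF A(1)]] by simp
  qed
  \<comment> \<open>On \<open>N\<close> the density is 1 inside \<open>Q\<close> and -1 outside,
    which separates the singular contribution from the integral of \<open>f'\<close>.\<close>
  have on_N_fun: "(\<lambda>x. indicator A x *\<^sub>R F x) = (\<lambda>x. indicator (- N) x *\<^sub>R (indicator A x *\<^sub>R F x)
      + (indicator (A \<inter> Q \<inter> N) x - indicator ((A - Q) \<inter> N) x))" for A
    by (rule ext) (auto simp: F_def indicator_def)
  have ind_int: "integrable M (indicator A :: real \<Rightarrow> real)" if "A \<in> sets borel" for A
    using that by (simp add: M(1) integrable_indicator_iff emeasure_eq_measure)
  have F_A: "integrable M (\<lambda>x. indicator A x *\<^sub>R F x)" "(LINT x|M. indicator A x *\<^sub>R F x) = Df A"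
    if A: "A \<in> sets borel" "A \<subseteq> {a..b}" for A
  proof -
    have sets: "A \<inter> Q \<in> sets borel" "A - Q \<in> sets borel" "A \<inter> Q \<inter> N \<in> sets borel" "(A - Q) \<inter> N \<in> sets borel"
      using A(1) Q' N'(1) by auto
    note i = int_off[OF A] ind_int[OF sets(3)] ind_int[OF sets(4)]
    show "integrable M (\<lambda>x. indicator A x *\<^sub>R F x)"
      by (subst on_N_fun) (intro Bochner_Integration.integrable_add Bochner_Integration.integrable_diff i)
    have "(LINT x|M. indicator A x *\<^sub>R F x) = (LINT x:A|lebesgue. f' x)
        + (measure M (A \<inter> Q \<inter> N) - measure M ((A - Q) \<inter> N))"
    proof (subst on_N_fun)
      show "(LINT x|M. indicator (- N) x *\<^sub>R (indicator A x *\<^sub>R F x)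
          + (indicator (A \<inter> Q \<inter> N) x - indicator ((A - Q) \<inter> N) x)) = (LINT x:A|lebesgue. f' x)
        + (measure M (A \<inter> Q \<inter> N) - measure M ((A - Q) \<inter> N))"
        unfolding Bochner_Integration.integral_add[OF i(1) Bochner_Integration.integrable_diff[OF i(2,3)]]
          Bochner_Integration.integral_diff[OF i(2,3)] eq_off[OF A]
        using sets by (simp add: M(1))
    qed
    also have "measure M (A \<inter> Q \<inter> N) = Dsf (A \<inter> N \<inter> Q)"
    proof -
      have eqs: "A \<inter> Q \<inter> N \<inter> Q = A \<inter> N \<inter> Q" "A \<inter> Q \<inter> N - Q = {}" by auto
      then show ?thesis
        unfolding M_N[OF sets(1)] \<mu>_def variation_of_def eqs signed_measure_empty[OF sm] by simp
    qed
    also have "measure M ((A - Q) \<inter> N) = - Dsf (A \<inter> N - Q)"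
    proof -
      have eqs: "(A - Q) \<inter> N \<inter> Q = {}" "(A - Q) \<inter> N - Q = A \<inter> N - Q" by auto
      then show ?thesis
        unfolding M_N[OF sets(2)] \<mu>_def variation_of_def eqs signed_measure_empty[OF sm] by simp
    qed
    also have "Dsf (A \<inter> N \<inter> Q) - - Dsf (A \<inter> N - Q) = Dsf A"
    proof -
      have AR: "A \<in> sets ?R" "A \<inter> N \<in> sets ?R" using A N(1) by (auto simp: sets_borel_on)
      have "Dsf (A - N) = 0" using AR N(1) by (intro N(3)) auto
      then show ?thesis
        using signed_measure_split[OF sm AR(1) N(1)] signed_measure_split[OF sm AR(2) Q(1)] by simp
    qed
    also have "(LINT x:A|lebesgue. f' x) + Dsf A = Df A"
      using Df_eq[of A] A by (simp add: sets_borel_on)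
    finally show "(LINT x|M. indicator A x *\<^sub>R F x) = Df A" .
  qed
  \<comment> \<open>A single point is Lebesgue null, so \<open>Df {b} = 0\<close> leaves no atom of
    the singular part at \<open>b\<close>.\<close>
  have Dsf_b: "Dsf {b} = 0"
  proof -
    have bR: "{b} \<in> sets ?R" using ab by (simp add: sets_borel_on)
    have "AE x in lebesgue. x \<notin> {b}" by (intro AE_completion AE_not_in) simp
    then have "AE x in lebesgue. indicator {b} x *\<^sub>R f' x = 0" by eventually_elim simp
    then have "(LINT x:{b}|lebesgue. f' x) = 0"
      unfolding set_lebesgue_integral_def by (rule integral_eq_zero_AE)
    then show ?thesis using Df_eq[OF bR] Df_b by simp
  qed
  have conc: "AE x in M. x \<in> {a..<b}"
  proof -
    \<comment> \<open>A singleton lies on one side of \<open>Q\<close>, so both terms of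
      \<open>variation_of\<close> are \<open>Dsf {b}\<close> or \<open>Dsf {}\<close>.\<close>
    have "{b} \<inter> Q = {} \<or> {b} \<inter> Q = {b}" "{b} - Q = {} \<or> {b} - Q = {b}" by auto
    then have "\<mu> {b} = 0"
      using Dsf_b signed_measure_empty[OF sm] unfolding \<mu>_def variation_of_def by (elim disjE) simp_all
    moreover have "- {a..<b} \<inter> {a..b} = {b}" using ab by auto
    ultimately have "measure M (- {a..<b}) = 0" using M(3)[of "- {a..<b}"] by simp
    then have "- {a..<b} \<in> null_sets M" by (auto simp: M(1) emeasure_eq_measure)
    from AE_not_in[OF this] show ?thesis by simp
  qed
  show ?thesis
  proof (rule that)
    show "N \<subseteq> {a..b}" by (rule N'(2))
    show "total_variation ?R Dsf A = emeasure M (A \<inter> N)" if A: "A \<in> sets borel" "A \<subseteq> {a..b}" for A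
    proof -
      have AR: "A \<in> sets ?R" using A by (simp add: sets_borel_on)
      have "\<mu> (A - N) = 0" using AR N(1) by (intro \<mu>_zero) auto
      then have "\<mu> A = \<mu> (A \<inter> N)" using signed_measure_split[OF sm_\<mu> AR N(1)] by simp
      then show ?thesis using tv[OF AR] M_N[OF A(1)] by (simp add: emeasure_eq_measure)
    qed
    show "(\<integral>\<^sup>+x\<in>{a..b}. ennreal (\<bar>f' x\<bar> powr p x) \<partial>lebesgue) =
       (\<integral>\<^sup>+x. ennreal (indicator (- N) x) * ennreal (\<bar>F x\<bar> powr p x) \<partial>M)"
    proof -
      have p_meas: "p \<in> borel_measurable borel" by (rule borel_measurable_continuous_onI[OF p(1)])
      have h: "(\<lambda>x. ennreal (\<bar>F x\<bar> powr p x)) \<in> borel_measurable borel"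
        using F_meas p_meas by measurable
      have "AE x in lebesgue. indicator {a..b} x * f' x = F x \<and> x \<notin> N"
        using F_AE N_AE by (intro AE_completion) auto
      then have "(\<integral>\<^sup>+x\<in>{a..b}. ennreal (\<bar>f' x\<bar> powr p x) \<partial>lebesgue) =
          (\<integral>\<^sup>+x. indicator ({a..b} - N) x * ennreal (\<bar>F x\<bar> powr p x) \<partial>lebesgue)"
        by (intro nn_integral_cong_AE, eventually_elim) (auto simp: indicator_def)
      also have "\<dots> = (\<integral>\<^sup>+x. indicator ({a..b} - N) x * ennreal (\<bar>F x\<bar> powr p x) \<partial>lborel)"
        by (rule nn_integral_completion)
      also have "\<dots> = (\<integral>\<^sup>+x. ennreal (\<bar>F x\<bar> powr p x) \<partial>density lborel (indicator ({a..b} - N)))"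
        using h N'(1) by (intro nn_integral_density[symmetric]) simp_all
      also have "\<dots> = (\<integral>\<^sup>+x. ennreal (\<bar>F x\<bar> powr p x) \<partial>density M (indicator (- N)))"
        by (simp only: dens)
      also have "\<dots> = (\<integral>\<^sup>+x. indicator (- N) x * ennreal (\<bar>F x\<bar> powr p x) \<partial>M)"
        using h N'(1) by (intro nn_integral_density) (simp_all add: measurable_cong_sets[OF M(1) refl] M(1))
      finally show ?thesis by (simp add: ennreal_indicator)
    qed
    show "derivative_density a b P f p F M N"
    proof
      show "a < b" "sets M = sets borel" "N \<in> sets borel" "F \<in> borel_measurable borel"
        "continuous_on UNIV p" "\<And>x. 1 \<le> p x" "\<And>x. p x \<le> P"
        by (fact ab M(1) N'(1) F_meas p)+
      show "\<bar>F x\<bar> = 1" if "x \<in> N" for x using that by (simp add: F_def)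
      show "AE x in M. x \<in> {a..<b}" by (rule conc)
      show "integrable M F"
      proof -
        have "AE x in M. indicator {a..b} x *\<^sub>R F x = F x" using conc by eventually_elim auto
        moreover have "F \<in> borel_measurable M"
          using F_meas by (simp add: measurable_cong_sets[OF M(1) refl])
        ultimately show ?thesis
          using integrable_cong_AE[of "\<lambda>x. indicator {a..b} x *\<^sub>R F x" M F] F_A(1)[of "{a..b}"]
            borel_measurable_integrable[OF F_A(1)[of "{a..b}"]] by simp
      qed
      fix c d assume cd: "a \<le> c" "c < d" "d \<le> b"
      show "measure M ({c..<d} - N) = d - c"
      proof -
        have "({c..<d} - N) \<inter> {a..b} = {c..<d} - N" using cd by auto
        moreover have "\<mu> ({c..<d} - N) = 0" using cd N' by (intro \<mu>_zero) (auto simp: sets_borel_on)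
        ultimately have "measure M ({c..<d} - N) = measure lborel ({c..<d} - N)"
          using M(3)[of "{c..<d} - N"] N'(1) by simp
        also have "\<dots> = measure lborel {c..<d}"
          using N(2) N'(1) by (intro measure_Diff_null_set) auto
        finally show ?thesis using cd by simp
      qed
      have sets: "{a..<c} \<in> sets ?R" "{a..<d} \<in> sets ?R" "{a..<c} \<subseteq> {a..<d}"
        using cd by (auto simp: sets_borel_on)
      have "{a..<d} - {a..<c} = {c..<d}" using cd by auto
      then have "Df {c..<d} = Df {a..<d} - Df {a..<c}"
        using signed_measure_Diff[OF sm_Df sets(2,1,3)] by simp
      also have "\<dots> = f d - f c" using f_Df[of c] f_Df[of d] cd by simp
      finally show "f d - f c = (LINT x:{c..<d}|M. F x)"
        using F_A(2)[of "{c..<d}"] cd unfolding set_lebesgue_integral_def by (simp add: subset_iff)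
    qed
  qed
qed

text \<open>A jump at a point with \<open>p > 1\<close> charges that set and makes \<open>V\<close>
  infinite. Vanishing of the singular part there is therefore concluded from
  \<open>V < \<infinity>\<close>, and the formula from this vanishing; the formula then also covers
  an infinite integral of the power of \<open>f'\<close>.\<close>

theorem corollary1p2:
  fixes a b :: real and \<Omega> :: "real set" and f p f' :: "real \<Rightarrow> real"
    and Df Dsf :: "real set \<Rightarrow> real"
  assumes "a < b" and "{a..b} \<subseteq> \<Omega>"
    and "bounded_variation_on a b f" and "left_continuous_on a b f"
    and "\<forall>x\<in>\<Omega>. 1 \<le> p x" and "bounded (p ` \<Omega>)" and "strong_log_Hoelder \<Omega> p"
    and "derivative_measure a b f Df"
    and "lebesgue_decomposition a b Df f' Dsf"
  defines "V \<equiv> riesz_variation (\<lambda>x t. ennreal (t powr p x)) a b f"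
    and "absDsf \<equiv> total_variation (borel_on a b) Dsf"
  shows "(V < \<infinity> \<longrightarrow> absDsf {x\<in>{a..b}. p x > 1} = 0) \<and>
         (absDsf {x\<in>{a..b}. p x > 1} = 0 \<longrightarrow>
            V = (\<integral>\<^sup>+x\<in>{a..b}. ennreal (\<bar>f' x\<bar> powr p x) \<partial>lebesgue)
                + absDsf {x\<in>{a..b}. p x = 1})"
proof -
  \<comment> \<open>Clamping the argument to \<open>{a..b}\<close> extends the exponent to a
    continuous function on the line with the same bounds. Neither the variation nor the integral
    over \<open>{a..b}\<close> sees the change.\<close>
  define q where "q x = p (max a (min b x))" for x
  have clamp: "max a (min b x) \<in> {a..b}" for x using assms(1) by auto
  have q_p: "q x = p x" if "x \<in> {a..b}" for x using that by (simp add: q_def)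
  have lh: "strong_log_Hoelder {a..b} p" by (rule strong_log_Hoelder_mono[OF assms(7,2)])
  then have lh_q: "strong_log_Hoelder {a..b} q"
    using strong_log_Hoelder_cong[of "{a..b}" p q] q_p by simp
  have q_cont: "continuous_on UNIV q"
    unfolding q_def using clamp
    by (intro continuous_on_compose2[OF strong_log_Hoelder_continuous_on[OF lh]] continuous_intros) auto
  have q_ge: "1 \<le> q x" for x
    unfolding q_def using clamp[of x] assms(2,5) by blast
  obtain P where "\<And>x. x \<in> \<Omega> \<Longrightarrow> \<bar>p x\<bar> \<le> P"
    using assms(6) by (auto simp: bounded_iff)
  then have q_le: "q x \<le> P" for x
    unfolding q_def using clamp[of x] assms(2) by (meson abs_le_D1 subsetD)
  obtain M N F where dd: "derivative_density a b P f q F M N"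
    and ac: "(\<integral>\<^sup>+x\<in>{a..b}. ennreal (\<bar>f' x\<bar> powr q x) \<partial>lebesgue) =
       (\<integral>\<^sup>+x. ennreal (indicator (- N) x) * ennreal (\<bar>F x\<bar> powr q x) \<partial>M)"
    and N: "N \<subseteq> {a..b}"
    and tv: "\<And>A. A \<in> sets borel \<Longrightarrow> A \<subseteq> {a..b} \<Longrightarrow> absDsf A = emeasure M (A \<inter> N)"
    unfolding absDsf_def
    by (rule exists_derivative_density[OF assms(1) q_cont q_ge q_le assms(8,9)]) blast
  have V: "V = riesz_variation (\<lambda>x t. ennreal (t powr q x)) a b f"
    unfolding V_def by (rule riesz_variation_cong) (simp add: q_p)
  have W: "(\<integral>\<^sup>+x\<in>{a..b}. ennreal (\<bar>f' x\<bar> powr p x) \<partial>lebesgue) =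
      (\<integral>\<^sup>+x\<in>{a..b}. ennreal (\<bar>f' x\<bar> powr q x) \<partial>lebesgue)"
    by (intro nn_integral_cong) (auto simp: q_p indicator_def)
  have q_meas: "q \<in> borel_measurable borel" by (rule borel_measurable_continuous_onI[OF q_cont])
  have "{x. 1 < q x} \<in> sets borel" "{x. q x = 1} \<in> sets borel" using q_meas by measurable
  then have sets: "{a..b} \<inter> {x. 1 < q x} \<in> sets borel" "{a..b} \<inter> {x. q x = 1} \<in> sets borel" by auto
  have eqs: "{x\<in>{a..b}. 1 < p x} = {a..b} \<inter> {x. 1 < q x}" "{x\<in>{a..b}. p x = 1} = {a..b} \<inter> {x. q x = 1}"
    "{a..b} \<inter> {x. 1 < q x} \<inter> N = {x\<in>N. 1 < q x}" "{a..b} \<inter> {x. q x = 1} \<inter> N = {x\<in>N. q x = 1}"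
    using N by (auto simp: q_p)
  have absDsf: "absDsf {x\<in>{a..b}. p x > 1} = emeasure M {x\<in>N. q x > 1}"
    "absDsf {x\<in>{a..b}. p x = 1} = emeasure M {x\<in>N. q x = 1}"
    using tv[OF sets(1)] tv[OF sets(2)] unfolding eqs by auto
  show ?thesis
    unfolding V W ac absDsf by (rule derivative_density.riesz_variation_representation[OF dd lh_q])
qed

end
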